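(* Let $k\ge 2$ and $m$ be integers and $\mathfrak P=(P)$ with $\deg P=1$, $P(0)=1$. For $0\le i\le q-2$ let $N_i=\lfloor\frac{k-2-i}{q-1}\rfloor$ and let $S_{k,m}(\Gamma_1(T))_i$ be the subspace spanned by $\mathbf c_{i+\nu(q-1)}$, $0\le\nu\le N_i$ (so $S_{k,m}(\Gamma_1(T))=\bigoplus_{i=0}^{q-2}S_{k,m}(\Gamma_1(T))_i$). Then each $S_{k,m}(\Gamma_1(T))_i$ is invariant under $T_{\mathfrak P}$, and if $\mathbf c=\sum_{\nu=0}^{N_i}x_\nu\mathbf c_{i+\nu(q-1)}$ then $T_{\mathfrak P}\mathbf c=\sum_{\mu=0}^{N_i}y_\mu\mathbf c_{i+\mu(q-1)}$ with $y_\mu=\sum_{\nu}M_{\mu\nu}x_\nu$, where the $(N_i+1)\times(N_i+1)$ matrix $M=[T_{\mathfrak P}]_i$ (indices $0\le\mu,\nu\le N_i$) has entries $$M_{\mu\mu}=\alpha^{(i)}_{\mu,0}+P^{k-2-(i+\mu(q-1))},\qquad M_{\mu\nu}=\alpha^{(i)}_{\mu,\mu-\nu}\ (\nu<\mu),\qquad M_{\mu\nu}=\beta^{(i)}_{\mu,\nu-\mu}\ (\nu>\mu),$$ with, for $0\le\mu\le N_i$, $0\le\mu'\le\mu$, $1\le n\le N_i-\mu$, $$\alpha^{(i)}_{\mu,\mu'}=\sum_{l=0}^{i+(\mu-\mu')(q-1)}\binom{i+\mu(q-1)}{l+\mu'(q-1)}\binom{k-2-(i+\mu(q-1))}{l}(1-P)^l-P^{k-2-(i+\mu(q-1))}\binom{i+\mu(q-1)}{\mu'(q-1)},$$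 $$\beta^{(i)}_{\mu,n}=\sum_{l=n(q-1)}^{k-2-(i+\mu(q-1))}\binom{i+\mu(q-1)}{l-n(q-1)}\binom{k-2-(i+\mu(q-1))}{l}(1-P)^l-P^{i+\mu(q-1)}\binom{k-2-(i+\mu(q-1))}{n(q-1)}T^{n(q-1)}.$$
   Context: Let $\mathbb F$ be a finite field with $q$ elements, $A=\mathbb F[T]$, $K_\infty=\mathbb F((1/T))$, $\mathcal O_\infty$ its valuation ring, $C$ the completion of an algebraic closure of $K_\infty$, $\Omega=C\setminus K_\infty$ with $\mathrm{GL}_2(K_\infty)$ acting by fractional linear transformations, $(f|_{k,m}\gamma)(z)=f(\gamma z)(\det\gamma)^m(cz+d)^{-k}$. $S_{k,m}(\Gamma)$ denotes the space of Drinfeld cusp forms of weight $k$, type $m$ for a congruence subgroup $\Gamma$. $\Gamma_1(T)=\{\begin{pmatrix}a&b\\c&d\end{pmatrix}\in\mathrm{GL}_2(A): a\equiv d\equiv1,\ c\equiv0\bmod T\}$. Cusp forms are identified via the residue isomorphism $\mathrm{Res}(f)(e)(X^jY^{k-2-j})=\mathrm{Res}_e z^jf(z)dz$ with harmonic cocycles: maps $\mathbf c$ from directed edges of the Bruhat–Tits tree of $\mathrm{PGL}_2(K_\infty)$ (edges $=\mathrm{PGL}_2(K_\infty)/\mathfrak I_\infty$, $\mathfrak I_\infty$ the Iwahori subgroup, $\langle g\rangle$ the edge of $g$) to $\mathrm{Hom}(V(k,m),C)$, $V(k,m)$ with basis $X^jY^{k-2-j}$, satisfying harmonicity and $\mathbf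 c(\gamma e)=\gamma\mathbf c(e)$ for $\gamma\in\Gamma$, where $(\gamma w)(X^jY^{k-2-j})=(\det\gamma)^{1-m}w((aX+bY)^j(cX+dY)^{k-2-j})$. Hecke operator for $\mathfrak P=(P)\ne(T)$, $P(0)=1$, $d=\deg P$: $T_{\mathfrak P}f=P^{k-m-1}\big[f|_{k,m}\begin{pmatrix}P&0\\0&1\end{pmatrix}+\sum_{b\in A,\deg b<d}f|_{k,m}\begin{pmatrix}1&b(1-P)\\0&P\end{pmatrix}\big]$. $\gamma_0=\langle\begin{pmatrix}0&1\\1&0\end{pmatrix}\rangle$; a cocycle for $\Gamma_1(T)$ is uniquely determined by its value at $\gamma_0$, any value being possible; $\mathbf c_j$ ($0\le j\le k-2$) is the cocycle with $\mathbf c_j(\gamma_0)(X^lY^{k-2-l})=\delta_{lj}$. Binomial coefficients are read in $\mathbb F$. *)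

theory Defs
  imports "HOL-Library.Cardinality" "HOL-Computational_Algebra.Polynomial" "HOL-Computational_Algebra.Formal_Laurent_Series"
begin

(* K_infinity = F((1/T)) is modelled as 'a fls; the Laurent variable X is the uniformiser
   pi = 1/T, so T = fls_X_inv.  A = F[T] is 'a poly, embedded via polyK. *)

definition polyK :: "'a::field poly \<Rightarrow> 'a fls" where
  "polyK p = (\<Sum>i\<le>degree p. fls_const (coeff p i) * fls_X_inv ^ i)"

datatype 'f m2 = M2 (ma: 'f) (mb: 'f) (mc: 'f) (md: 'f)

fun m2mul :: "'f::comm_ring_1 m2 \<Rightarrow> 'f m2 \<Rightarrow> 'f m2" where
  "m2mul (M2 a b c d) (M2 a' b' c' d') =
     M2 (a*a' + b*c') (a*b' + b*d') (c*a' + d*c') (c*b' + d*d')"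

fun m2det :: "'f::comm_ring_1 m2 \<Rightarrow> 'f" where
  "m2det (M2 a b c d) = a*d - b*c"

fun m2inv :: "'f::field m2 \<Rightarrow> 'f m2" where
  "m2inv (M2 a b c d) = M2 (d / (a*d-b*c)) (- b / (a*d-b*c)) (- c / (a*d-b*c)) (a / (a*d-b*c))"

fun m2scale :: "'f::comm_ring_1 \<Rightarrow> 'f m2 \<Rightarrow> 'f m2" where
  "m2scale t (M2 a b c d) = M2 (t*a) (t*b) (t*c) (t*d)"

fun m2map :: "('f \<Rightarrow> 'g) \<Rightarrow> 'f m2 \<Rightarrow> 'g m2" where
  "m2map f (M2 a b c d) = M2 (f a) (f b) (f c) (f d)"

definition inO :: "'a::field fls \<Rightarrow> bool" where
  "inO x \<longleftrightarrow> x = 0 \<or> fls_subdegree x \<ge> 0"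
definition inPO :: "'a::field fls \<Rightarrow> bool" where
  "inPO x \<longleftrightarrow> x = 0 \<or> fls_subdegree x \<ge> 1"
definition unitO :: "'a::field fls \<Rightarrow> bool" where
  "unitO x \<longleftrightarrow> x \<noteq> 0 \<and> fls_subdegree x = 0"

definition iwahori :: "'a::field fls m2 \<Rightarrow> bool" where
  "iwahori h \<longleftrightarrow> inO (ma h) \<and> inO (mb h) \<and> inPO (mc h) \<and> inO (md h) \<and> unitO (m2det h)"

definition Gamma1T :: "'a::field poly m2 \<Rightarrow> bool" where
  "Gamma1T g \<longleftrightarrow> poly (ma g) 0 = 1 \<and> poly (md g) 0 = 1 \<and> poly (mc g) 0 = 0
      \<and> m2det g \<noteq> 0 \<and> degree (m2det g) = 0"

(* Action of gamma on Hom(V(k,m),C): w is given by its values w j = w(X^j Y^(k-2-j)),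
   iota : K_infinity -> C is the embedding. *)
definition act :: "nat \<Rightarrow> int \<Rightarrow> ('a::field fls \<Rightarrow> 'c::field) \<Rightarrow> 'a fls m2
                     \<Rightarrow> (nat \<Rightarrow> 'c) \<Rightarrow> nat \<Rightarrow> 'c" where
  "act k m \<iota> g w j =
     (if j \<le> k - 2 then
        \<iota> (m2det g) powi (1 - m) *
        (\<Sum>r\<le>j. \<Sum>s\<le>k-2-j.
           \<iota> (of_nat ((j choose r) * ((k-2-j) choose s)) *
               ma g ^ r * mb g ^ (j - r) * mc g ^ s * md g ^ (k-2-j-s)) * w (r + s))
      else 0)"

definition wmat :: "'a::field fls m2" where
  "wmat = M2 0 1 fls_X 0"

(* harmonic cocycles for Gamma_1(T) of weight k and type m, as functions on GL_2(K_inf)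
   that are constant on the edge classes  g PZ I  (edges = PGL_2(K_inf)/I). *)
definition hcocycle :: "nat \<Rightarrow> int \<Rightarrow> ('a::{finite,field} fls \<Rightarrow> 'c::field)
                          \<Rightarrow> ('a fls m2 \<Rightarrow> nat \<Rightarrow> 'c) \<Rightarrow> bool" where
  "hcocycle k m \<iota> c \<longleftrightarrow>
     (\<forall>g j. k - 2 < j \<longrightarrow> c g j = 0) \<and>
     (\<forall>g t h. m2det g \<noteq> 0 \<longrightarrow> t \<noteq> 0 \<longrightarrow> iwahori h \<longrightarrow> c (m2mul (m2scale t g) h) = c g) \<and>
     (\<forall>g. m2det g \<noteq> 0 \<longrightarrow> c (m2mul g wmat) = (\<lambda>j. - c g j)) \<and>
     (\<forall>g j. m2det g \<noteq> 0 \<longrightarrow>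
        c g j + (\<Sum>u\<in>UNIV. c (m2mul g (M2 (fls_const u) 1 1 0)) j) = 0) \<and>
     (\<forall>\<gamma> g. Gamma1T \<gamma> \<longrightarrow> m2det g \<noteq> 0 \<longrightarrow>
        c (m2mul (m2map polyK \<gamma>) g) = act k m \<iota> (m2map polyK \<gamma>) (c g))"

(* Hecke operator transported to cocycles via the residue map:
   Res(f|_{k,m} g)(e) = g^{-1} Res(f)(g e). *)
definition hecke :: "nat \<Rightarrow> int \<Rightarrow> ('a::{finite,field} fls \<Rightarrow> 'c::field) \<Rightarrow> 'a poly
                       \<Rightarrow> ('a fls m2 \<Rightarrow> nat \<Rightarrow> 'c) \<Rightarrow> 'a fls m2 \<Rightarrow> nat \<Rightarrow> 'c" where
  "hecke k m \<iota> P c g j =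
     \<iota> (polyK P) powi (int k - m - 1) *
       (act k m \<iota> (m2inv (M2 (polyK P) 0 0 1)) (c (m2mul (M2 (polyK P) 0 0 1) g)) j
        + (\<Sum>u\<in>UNIV. let h = M2 1 (polyK ([:u:] * (1 - P))) 0 (polyK P) in
                        act k m \<iota> (m2inv h) (c (m2mul h g)) j))"

definition gamma0 :: "'a::field fls m2" where
  "gamma0 = M2 0 1 1 0"

definition Idx :: "nat \<Rightarrow> nat \<Rightarrow> nat \<Rightarrow> nat set" where
  "Idx q k i = {\<nu>. i + \<nu> * (q - 1) \<le> k - 2}"

definition alpha :: "'a::{finite,field} poly \<Rightarrow> nat \<Rightarrow> nat \<Rightarrow> nat \<Rightarrow> nat \<Rightarrow> 'a fls" where
  "alpha P k i \<mu> \<kappa> =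
     (let q = card (UNIV :: 'a set); j = i + \<mu> * (q - 1); Pf = polyK P in
      (\<Sum>l = 0..i + (\<mu> - \<kappa>) * (q - 1).
          of_nat (j choose (l + \<kappa> * (q - 1))) * of_nat ((k - 2 - j) choose l) * (1 - Pf) ^ l)
      - Pf ^ (k - 2 - j) * of_nat (j choose (\<kappa> * (q - 1))))"

definition beta :: "'a::{finite,field} poly \<Rightarrow> nat \<Rightarrow> nat \<Rightarrow> nat \<Rightarrow> nat \<Rightarrow> 'a fls" where
  "beta P k i \<mu> n =
     (let q = card (UNIV :: 'a set); j = i + \<mu> * (q - 1); Pf = polyK P in
      (\<Sum>l = n * (q - 1)..k - 2 - j.
          of_nat (j choose (l - n * (q - 1))) * of_nat ((k - 2 - j) choose l) * (1 - Pf) ^ l)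
      - Pf ^ j * of_nat ((k - 2 - j) choose (n * (q - 1))) * fls_X_inv ^ (n * (q - 1)))"

definition heckeM :: "'a::{finite,field} poly \<Rightarrow> nat \<Rightarrow> nat \<Rightarrow> nat \<Rightarrow> nat \<Rightarrow> 'a fls" where
  "heckeM P k i \<mu> \<nu> =
     (if \<nu> = \<mu> then alpha P k i \<mu> 0 + polyK P ^ (k - 2 - (i + \<mu> * (CARD('a) - 1)))
      else if \<nu> < \<mu> then alpha P k i \<mu> (\<mu> - \<nu>)
      else beta P k i \<mu> (\<nu> - \<mu>))"

end

theory Submission
  imports Defs
begin

text \<open>
  The product of a representative of the Hecke correspondence with \<open>\<gamma> \<in> \<Gamma>\<^sub>1(T)\<close> is again
  \<open>\<Gamma>\<^sub>1(T)\<close> times a representative, and \<open>\<gamma>\<close> permutes the representatives like the points of the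
  projective line over \<open>A/P\<close>; hence the Hecke operator preserves cocycles.  The value at
  \<open>\<gamma>\<^sub>0\<close> involves the cocycle on \<open>q + 1\<close> edges near \<open>\<gamma>\<^sub>0\<close>.  The edges of the representatives
  \<open>diag(P,1)\<close> and \<open>diag(1,P)\<close> lead away from \<open>\<gamma>\<^sub>0\<close> towards the two cusps, and harmonicity expresses
  their values as sums over the upper and lower unipotent translates of \<open>\<gamma>\<^sub>0\<close>; each of the other
  edges is itself a reversed translate of \<open>\<gamma>\<^sub>0\<close>.  This gives the value at \<open>\<gamma>\<^sub>0\<close> as a sum of
  products of powers of linear forms over the finite field, and orthogonality of power sums leaves
  only the exponents congruent modulo \<open>q - 1\<close>.
\<close>

subsection \<open>Power sums in a finite field\<close>

text \<open>Multiplication by \<open>u\<close> permutes the nonzero elements, so their product,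
  itself nonzero, absorbs the factor \<open>u ^ (CARD('a) - 1)\<close>.\<close>

lemma finite_field_power_card_minus_1:
  fixes u :: "'a::{finite,field}"
  assumes "u \<noteq> 0"
  shows "u ^ (CARD('a) - 1) = 1"
proof -
  let ?S = "UNIV - {0::'a}"
  have bij: "bij_betw ((*) u) ?S ?S"
    by (rule bij_betw_byWitness[where f' = "\<lambda>x. x / u"]) (use assms in auto)
  have "(\<Prod>x\<in>?S. x) = (\<Prod>x\<in>?S. u * x)"
    using prod.reindex_bij_betw[OF bij, of "\<lambda>x. x"] by simp
  also have "\<dots> = u ^ (CARD('a) - 1) * (\<Prod>x\<in>?S. x)"
    by (simp add: prod.distrib)
  finally show ?thesis by simp
qed

lemma card_field_ge_2: "CARD('a::{finite,field}) \<ge> 2"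
proof -
  have "card {0, 1 :: 'a} \<le> CARD('a)" by (rule card_mono) auto
  then show ?thesis by simp
qed

text \<open>Translation by 1 permutes the field, so the sum of all elements equals itself plus their
  number.\<close>

lemma of_nat_card_field_eq_0: "of_nat CARD('a) = (0 :: 'a::{finite,field})"
proof -
  have bij: "bij_betw (\<lambda>x::'a. x + 1) UNIV UNIV"
    by (rule bij_betw_byWitness[where f' = "\<lambda>x. x - 1"]) auto
  have "(\<Sum>x\<in>UNIV. x) = (\<Sum>x\<in>UNIV. x + 1 :: 'a)"
    using sum.reindex_bij_betw[OF bij, of "\<lambda>x. x"] by simp
  then show ?thesis by (simp add: sum.distrib)
qed

text \<open>Otherwise, with \<open>r\<close> the remainder of \<open>n\<close> modulo
  \<open>CARD('a) - 1\<close>, the nonzero polynomial \<open>monom 1 r - 1\<close> would have all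
  \<open>CARD('a) - 1 > r\<close> nonzero elements as roots.\<close>

lemma finite_field_exists_power_neq_1:
  assumes "\<not> (CARD('a) - 1) dvd n"
  shows "\<exists>u :: 'a::{finite,field}. u \<noteq> 0 \<and> u ^ n \<noteq> 1"
proof (rule ccontr)
  assume "\<not> ?thesis"
  then have all: "u ^ n = 1" if "u \<noteq> 0" for u :: 'a using that by blast
  define r where "r = n mod (CARD('a) - 1)"
  have q: "CARD('a) - 1 > 0" using card_field_ge_2[where 'a='a] by simp
  have r: "0 < r" "r < CARD('a) - 1"
    using assms q by (auto simp: r_def dvd_eq_mod_eq_0)
  have one: "u ^ r = 1" if "u \<noteq> 0" for u :: 'a
  proof -
    have "u ^ n = u ^ ((CARD('a) - 1) * (n div (CARD('a) - 1)) + r)" by (simp add: r_def)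
    also have "\<dots> = u ^ r"
      unfolding power_add power_mult by (simp only: finite_field_power_card_minus_1[OF that]) simp
    finally show ?thesis using all[OF that] by simp
  qed
  let ?p = "monom 1 r - 1 :: 'a poly"
  have "coeff ?p r = 1" using r by simp
  then have p: "?p \<noteq> 0" by (metis coeff_0 zero_neq_one)
  have "degree ?p \<le> r" by (intro degree_diff_le) (auto simp: degree_monom_le)
  moreover have "card {x. poly ?p x = 0} \<le> degree ?p"
    by (rule card_poly_roots_bound[OF p])
  moreover have "card (UNIV - {0::'a}) \<le> card {x. poly ?p x = 0}"
    by (rule card_mono) (auto simp: poly_monom one)
  ultimately show False using r by simp
qed

text \<open>If every term is 1, the sum is \<open>CARD('a) - 1\<close>, that is -1 in the field.
  Otherwise scaling by some \<open>v\<close> with \<open>v ^ n \<noteq> 1\<close> multiplies the sum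
  by \<open>v ^ n\<close> and also leaves it unchanged.\<close>

lemma sum_power_nonzero:
  "(\<Sum>u\<in>UNIV - {0}. u ^ n) = (if (CARD('a) - 1) dvd n then - 1 else (0 :: 'a::{finite,field}))"
proof (cases "(CARD('a) - 1) dvd n")
  case True
  then have "u ^ n = 1" if "u \<noteq> 0" for u :: 'a
    using finite_field_power_card_minus_1[OF that] by (auto simp: dvd_def power_mult)
  then have "(\<Sum>u\<in>UNIV - {0::'a}. u ^ n) = (\<Sum>u\<in>UNIV - {0::'a}. 1)"
    by (intro sum.cong) auto
  also have "\<dots> = of_nat (CARD('a) - 1)" by simp
  also have "\<dots> = of_nat CARD('a) - 1"
    using card_field_ge_2[where 'a='a] by (simp add: of_nat_diff)
  finally show ?thesis using True of_nat_card_field_eq_0[where 'a='a] by simp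
next
  case False
  then obtain v :: 'a where v: "v \<noteq> 0" "v ^ n \<noteq> 1"
    using finite_field_exists_power_neq_1 by blast
  let ?S = "UNIV - {0::'a}"
  have bij: "bij_betw ((*) v) ?S ?S"
    by (rule bij_betw_byWitness[where f' = "\<lambda>x. x / v"]) (use v in auto)
  have "(\<Sum>u\<in>?S. u ^ n) = (\<Sum>u\<in>?S. (v * u) ^ n)"
    using sum.reindex_bij_betw[OF bij, of "\<lambda>x. x ^ n"] by simp
  also have "\<dots> = v ^ n * (\<Sum>u\<in>?S. u ^ n)"
    by (simp add: power_mult_distrib sum_distrib_left)
  finally have "(v ^ n - 1) * (\<Sum>u\<in>?S. u ^ n) = 0" by (simp add: algebra_simps)
  then show ?thesis using v False by simp
qed

text \<open>The case \<open>n = 0\<close> is exceptional because \<open>0 ^ 0 = 1\<close>: the term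
  at zero then cancels the -1 from the others.\<close>

lemma sum_power_UNIV:
  "(\<Sum>u\<in>UNIV. u ^ n) =
     (if n > 0 \<and> (CARD('a) - 1) dvd n then - 1 else (0 :: 'a::{finite,field}))"
proof -
  have "(\<Sum>u\<in>UNIV. u ^ n) = 0 ^ n + (\<Sum>u\<in>UNIV - {0::'a}. u ^ n)"
    by (subst sum.remove[of _ 0]) auto
  then show ?thesis by (cases "n = 0") (auto simp: sum_power_nonzero of_nat_card_field_eq_0)
qed

text \<open>Inversion permutes the nonzero elements, which reduces negative exponents to positive
  ones. Integer exponents occur where both \<open>u\<close> and \<open>inverse u\<close> enter the
  linear forms.\<close>

lemma sum_power_int_nonzero:
  "(\<Sum>u\<in>UNIV - {0}. u powi z) =
     (if int (CARD('a) - 1) dvd z then - 1 else (0 :: 'a::{finite,field}))"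
proof (cases "z \<ge> 0")
  case True
  then obtain n where "z = int n" using nonneg_int_cases by blast
  then show ?thesis by (simp add: sum_power_nonzero int_dvd_int_iff del: of_nat_diff)
next
  case False
  then obtain n where z: "z = - int n" by (metis int_cases2 linorder_linear neg_0_le_iff_le of_nat_0_le_iff)
  have bij: "bij_betw inverse (UNIV - {0::'a}) (UNIV - {0})"
    by (rule bij_betw_byWitness[where f' = inverse]) auto
  have "(\<Sum>u\<in>UNIV - {0::'a}. u powi z) = (\<Sum>u\<in>UNIV - {0}. inverse u ^ n)"
    by (simp add: z power_int_minus power_inverse)
  also have "\<dots> = (\<Sum>u\<in>UNIV - {0}. u ^ n)"
    using sum.reindex_bij_betw[OF bij, of "\<lambda>x. x ^ n"] by simp
  finally show ?thesis by (simp add: z sum_power_nonzero int_dvd_int_iff del: of_nat_diff)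
qed

subsection \<open>Matrices and the embedding of polynomials\<close>

lemma m2mul_assoc: "m2mul (m2mul x y) z = m2mul x (m2mul y z)"
  by (cases x; cases y; cases z) (simp add: algebra_simps)

lemma m2det_mult: "m2det (m2mul x y) = m2det x * m2det y"
  by (cases x; cases y) (simp add: algebra_simps)

lemma m2mul_scale_right: "m2mul x (m2scale t y) = m2scale t (m2mul x y)"
  by (cases x; cases y) (simp add: algebra_simps)

lemma m2mul_inv_left:
  assumes "m2det (x :: 'a::field m2) \<noteq> 0"
  shows "m2mul (m2inv x) x = M2 1 0 0 1" "m2mul x (m2inv x) = M2 1 0 0 1"
  using assms by (cases x; simp add: divide_simps; simp add: algebra_simps)+

lemma m2det_inv:
  assumes "m2det (x :: 'a::field m2) \<noteq> 0"
  shows "m2det (m2inv x) = inverse (m2det x)"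
  using assms m2det_mult[of "m2inv x" x] by (simp add: m2mul_inv_left field_simps)

lemma m2mul_one [simp]: "m2mul (M2 1 0 0 1) x = x" "m2mul x (M2 1 0 0 1) = x"
  by (cases x; simp)+

lemma polyK_eq_sum:
  assumes "degree p \<le> n"
  shows "polyK p = (\<Sum>i\<le>n. fls_const (coeff p i) * fls_X_inv ^ i)"
  unfolding polyK_def using assms
  by (intro sum.mono_neutral_left) (auto simp: coeff_eq_0)

lemma polyK_pCons: "polyK (pCons a p) = fls_const a + fls_X_inv * polyK p"
  by (subst polyK_eq_sum[OF degree_pCons_le], subst sum.atMost_Suc_shift)
     (simp add: polyK_def sum_distrib_left algebra_simps)

lemma polyK_0 [simp]: "polyK 0 = 0"
  by (simp add: polyK_def)

lemma polyK_1 [simp]: "polyK 1 = 1"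
  by (simp add: polyK_def)

lemma polyK_add: "polyK (p + r) = polyK p + polyK r"
  by (subst (1 2 3) polyK_eq_sum[of _ "max (degree p) (degree r)"])
     (auto simp: degree_add_le_max sum.distrib algebra_simps simp flip: fls_plus_const)

lemma polyK_smult: "polyK (smult a p) = fls_const a * polyK p"
  by (subst (1 2) polyK_eq_sum[of _ "degree p"])
     (auto simp: sum_distrib_left mult.assoc simp flip: fls_const_mult_const)

lemma polyK_mult: "polyK (p * r) = polyK p * polyK r"
  by (induction p) (simp_all add: polyK_pCons polyK_add polyK_smult algebra_simps)

lemma polyK_diff: "polyK (p - r) = polyK p - polyK r"
  using polyK_add[of "p - r" r] by (simp add: algebra_simps)

lemma m2map_polyK_mult:
  "m2map polyK (m2mul x y) = m2mul (m2map polyK x) (m2map polyK y)"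
  by (cases x; cases y) (simp add: polyK_add polyK_mult)

text \<open>The determinant is a constant polynomial, hence equal to its value at 0, and the
  congruences make that value 1.\<close>

lemma Gamma1T_det:
  assumes "Gamma1T g"
  shows "m2det g = 1"
proof -
  obtain a b c d where g: "g = M2 a b c d" by (cases g)
  have "poly (m2det g) 0 = 1" using assms by (simp add: g Gamma1T_def)
  moreover obtain e where "m2det g = [:e:]"
    using assms by (auto simp: Gamma1T_def elim: degree_eq_zeroE)
  ultimately show ?thesis by (simp add: one_pCons)
qed

lemma Gamma1T_iff:
  "Gamma1T (M2 a b c d) \<longleftrightarrow>
     poly a 0 = 1 \<and> poly d 0 = 1 \<and> poly c 0 = 0 \<and> a * d - b * c = 1"
  using Gamma1T_det[of "M2 a b c d"] by (auto simp: Gamma1T_def)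

subsection \<open>The action on polynomial functionals\<close>

lemma coeff_linear_poly_power':
  fixes a b :: "'a::comm_ring_1"
  shows "coeff ([:b, a:] ^ j) r = of_nat (j choose r) * a ^ r * b ^ (j - r)"
proof (cases "r \<le> j")
  case False
  have "degree ([:b, a:] ^ j) \<le> degree [:b, a:] * j" by (rule degree_power_le)
  also have "\<dots> \<le> j" by simp
  finally show ?thesis using False by (simp add: coeff_eq_0 binomial_eq_0)
qed (simp add: coeff_linear_poly_power)

lemma degree_linear_power_le:
  fixes a b :: "'a::comm_ring_1"
  shows "degree ([:b, a:] ^ j) \<le> j"
  by (rule degree_le) (simp add: coeff_linear_poly_power' binomial_eq_0)

text \<open>\<open>p\<close> encodes a binary form of degree \<open>n\<close> dehomogenised at
  \<open>Y = 1\<close>; here \<open>x\<close> and \<open>y\<close> replace X and Y. The degree is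
  carried separately because \<open>p\<close> alone does not determine it.\<close>

definition homog_subst :: "nat \<Rightarrow> 'k::comm_ring_1 poly \<Rightarrow> 'k poly \<Rightarrow> 'k poly \<Rightarrow> 'k poly" where
  "homog_subst n p x y = (\<Sum>r\<le>n. smult (coeff p r) (x ^ r * y ^ (n - r)))"

text \<open>Substitution respects products of forms. One linear factor at a time suffices, since the
  forms acted on are products of linear ones; the degree bound removes the coefficient of index
  \<open>Suc n\<close>.\<close>

lemma homog_subst_linear_mult:
  assumes "degree p \<le> n"
  shows "homog_subst (Suc n) ([:b, a:] * p) x y = (smult a x + smult b y) * homog_subst n p x y"
proof -
  have p: "[:b, a:] * p = smult b p + pCons 0 (smult a p)" by simp
  have "homog_subst (Suc n) ([:b, a:] * p) x y
      = (\<Sum>r\<le>Suc n. smult (b * coeff p r) (x ^ r * y ^ (Suc n - r)))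
      + (\<Sum>r\<le>Suc n. smult (coeff (pCons 0 (smult a p)) r) (x ^ r * y ^ (Suc n - r)))"
    by (simp only: homog_subst_def p coeff_add coeff_smult smult_add_left sum.distrib)
  also have "(\<Sum>r\<le>Suc n. smult (b * coeff p r) (x ^ r * y ^ (Suc n - r)))
      = smult b y * homog_subst n p x y"
    using assms
    by (simp add: homog_subst_def sum_distrib_left coeff_eq_0 Suc_diff_le algebra_simps)
  also have "(\<Sum>r\<le>Suc n. smult (coeff (pCons 0 (smult a p)) r) (x ^ r * y ^ (Suc n - r)))
      = smult a x * homog_subst n p x y"
    by (subst sum.atMost_Suc_shift) (simp add: homog_subst_def sum_distrib_left algebra_simps)
  finally show ?thesis by (simp add: algebra_simps)
qed

lemma homog_subst_linear_powers:
  "homog_subst (j + l) ([:b, a:] ^ j * [:d, c:] ^ l) x y =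
     (smult a x + smult b y) ^ j * (smult c x + smult d y) ^ l"
proof (induction j)
  case 0
  show ?case
  proof (induction l)
    case 0
    show ?case by (simp add: homog_subst_def)
  next
    case (Suc l)
    then show ?case
      using homog_subst_linear_mult[OF degree_linear_power_le, where b = d and a = c]
      by (simp del: mult_pCons_left)
  qed
next
  case (Suc j)
  have "degree ([:b, a:] ^ j * [:d, c:] ^ l) \<le> degree ([:b, a:] ^ j) + degree ([:d, c:] ^ l)"
    by (rule degree_mult_le)
  also have "\<dots> \<le> j + l"
    by (intro add_mono degree_linear_power_le)
  finally show ?case
    using homog_subst_linear_mult[where p = "[:b, a:] ^ j * [:d, c:] ^ l" and n = "j + l"] Suc
    by (simp add: mult.assoc del: mult_pCons_left)
qed

section \<open>Field embeddings and functionals on binary forms\<close>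

locale field_embedding =
  fixes \<iota> :: "'k::field \<Rightarrow> 'c::field"
  assumes map_1 [simp]: "\<iota> 1 = 1"
    and map_add: "\<iota> (x + y) = \<iota> x + \<iota> y"
    and map_mult: "\<iota> (x * y) = \<iota> x * \<iota> y"
begin

lemma map_0 [simp]: "\<iota> 0 = 0"
  using map_add[of 0 0] by (metis add.right_neutral add_left_cancel)

lemma map_minus: "\<iota> (- x) = - \<iota> x"
  using map_add[of x "- x"] by (simp add: eq_neg_iff_add_eq_0 add.commute)

lemma map_power: "\<iota> (x ^ n) = \<iota> x ^ n"
  by (induction n) (simp_all add: map_mult)

lemma map_nonzero: "x \<noteq> 0 \<Longrightarrow> \<iota> x \<noteq> 0"
  using map_mult[of x "inverse x"] by auto

lemma map_inverse: "\<iota> (inverse x) = inverse (\<iota> x)"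
proof (cases "x = 0")
  case False
  then show ?thesis
    using map_mult[of x "inverse x"] by (simp add: map_nonzero inverse_unique)
qed simp

text \<open>The value of the functional \<open>w\<close> at the form \<open>p\<close> of degree \<open>n\<close>, dehomogenised by \<open>Y = 1\<close>.\<close>

definition pair :: "nat \<Rightarrow> (nat \<Rightarrow> 'c) \<Rightarrow> 'k poly \<Rightarrow> 'c" where
  "pair n w p = (\<Sum>r\<le>n. \<iota> (coeff p r) * w r)"

lemma pair_add: "pair n w (p + r) = pair n w p + pair n w r"
  by (simp add: pair_def map_add sum.distrib algebra_simps)

lemma pair_minus: "pair n w (- p) = - pair n w p"
  by (simp add: pair_def map_minus sum_negf)

lemma pair_sum: "pair n w (sum f A) = (\<Sum>x\<in>A. pair n w (f x))"
  by (induction A rule: infinite_finite_induct) (simp_all add: pair_add, simp_all add: pair_def)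

lemma pair_smult: "pair n w (smult a p) = \<iota> a * pair n w p"
  by (simp add: pair_def map_mult sum_distrib_left mult.assoc)

lemma pair_monom: "r \<le> n \<Longrightarrow> pair n w (monom a r) = \<iota> a * w r"
proof -
  assume r: "r \<le> n"
  have "pair n w (monom a r) = (\<Sum>s\<le>n. if s = r then \<iota> a * w r else 0)"
    unfolding pair_def by (intro sum.cong) auto
  then show ?thesis using r by simp
qed

end

lemma linear_power_eq_sum_monom:
  fixes a b :: "'a::comm_ring_1"
  shows "[:b, a:] ^ j = (\<Sum>r\<le>j. monom (of_nat (j choose r) * a ^ r * b ^ (j - r)) r)"
  by (rule poly_eqI) (auto simp: coeff_sum coeff_linear_poly_power' binomial_eq_0)

locale fls_embedding = field_embedding \<iota> for \<iota> :: "'a::field fls \<Rightarrow> 'c::field"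
begin

text \<open>The double sum in \<open>act\<close> is the binomial expansion of a product of powers of
  two linear forms; \<open>[:mb g, ma g:]\<close> is aX + bY at Y = 1.\<close>

lemma act_eq_pair:
  assumes "j \<le> k - 2"
  shows "act k m \<iota> g w j = \<iota> (m2det g) powi (1 - m) *
           pair (k - 2) w ([:mb g, ma g:] ^ j * [:md g, mc g:] ^ (k - 2 - j))"
proof -
  have "pair (k - 2) w ([:mb g, ma g:] ^ j * [:md g, mc g:] ^ (k - 2 - j)) =
    (\<Sum>r\<le>j. \<Sum>s\<le>k - 2 - j.
           \<iota> (of_nat ((j choose r) * ((k-2-j) choose s)) *
               ma g ^ r * mb g ^ (j - r) * mc g ^ s * md g ^ (k-2-j-s)) * w (r + s))"
    unfolding linear_power_eq_sum_monom sum_product pair_sum mult_monom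
    by (intro sum.cong refl, subst pair_monom) (use assms in \<open>auto simp: mult_ac\<close>)
  then show ?thesis using assms by (simp add: act_def)
qed

lemma act_add: "act k m \<iota> g (\<lambda>j. v j + w j) j = act k m \<iota> g v j + act k m \<iota> g w j"
  by (simp add: act_def algebra_simps sum.distrib)

lemma act_minus: "act k m \<iota> g (\<lambda>j. - w j) j = - act k m \<iota> g w j"
  by (simp add: act_def sum_negf)

lemma act_scale: "act k m \<iota> g (\<lambda>j. x * w j) j = x * act k m \<iota> g w j"
  by (simp add: act_def sum_distrib_left mult_ac)

lemma act_zero: "act k m \<iota> g (\<lambda>j. 0) j = 0"
  by (simp add: act_def)

lemma act_sum: "act k m \<iota> g (\<lambda>j. \<Sum>u\<in>A. f u j) j = (\<Sum>u\<in>A. act k m \<iota> g (f u) j)"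
  by (induction A rule: infinite_finite_induct) (simp_all add: act_zero act_add)

lemma act_gt: "k - 2 < j \<Longrightarrow> act k m \<iota> g w j = 0"
  by (simp add: act_def)

text \<open>Pairing \<open>act k m \<iota> h w\<close> with a form amounts to pairing
  \<open>w\<close> with the form in which the rows of \<open>h\<close> are substituted. Substituting
  them into the linear forms of \<open>g\<close> produces the rows of \<open>m2mul g h\<close>, and
  the determinant factors multiply.\<close>

lemma act_act: "act k m \<iota> g (act k m \<iota> h w) = act k m \<iota> (m2mul g h) w"
proof
  fix j
  obtain a b c d a' b' c' d' where gh: "g = M2 a b c d" "h = M2 a' b' c' d'"
    by (cases g; cases h)
  define n where "n = k - 2"
  show "act k m \<iota> g (act k m \<iota> h w) j = act k m \<iota> (m2mul g h) w j"
  proof (cases "j \<le> n")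
    case True
    let ?p = "[:b, a:] ^ j * [:d, c:] ^ (n - j)"
    have "pair n (act k m \<iota> h w) ?p =
       (\<Sum>r\<le>n. \<iota> (coeff ?p r) * (\<iota> (m2det h) powi (1 - m) *
          pair n w ([:b', a':] ^ r * [:d', c':] ^ (n - r))))"
      unfolding pair_def[of n "act k m \<iota> h w"]
      by (intro sum.cong refl, subst act_eq_pair) (auto simp: n_def gh)
    also have "\<dots> = \<iota> (m2det h) powi (1 - m) *
         pair n w (homog_subst n ?p [:b', a':] [:d', c':])"
      by (simp add: homog_subst_def pair_sum pair_smult sum_distrib_left mult_ac del: mult_pCons_left)
    also have "homog_subst n ?p [:b', a':] [:d', c':] =
        [:a * b' + b * d', a * a' + b * c':] ^ j * [:c * b' + d * d', c * a' + d * c':] ^ (n - j)"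
      using homog_subst_linear_powers[of j "n - j" b a d c "[:b', a':]" "[:d', c':]"] True by simp
    finally show ?thesis
      using True
      by (simp add: n_def act_eq_pair m2det_mult map_mult power_int_mult_distrib mult.assoc)
         (simp add: gh)
  qed (simp add: n_def act_gt)
qed

end

subsection \<open>The Hecke operator preserves cocycles\<close>

text \<open>The index runs over the projective line, with \<open>None\<close> as the point at
  infinity. When \<open>P\<close> is 1 at 0, the factor \<open>1 - P\<close> vanishes at 0, while at
  a root of \<open>P\<close> it is 1, so that the entry reduces to \<open>u\<close> there.\<close>

fun hecke_rep :: "'a::field poly \<Rightarrow> 'a option \<Rightarrow> 'a poly m2" where
  "hecke_rep P None = M2 P 0 0 1"
| "hecke_rep P (Some u) = M2 1 ([:u:] * (1 - P)) 0 P"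

lemma linear_dvd_iff_root:
  fixes P :: "'a::field poly"
  assumes "degree P = 1" "poly P t = 0"
  shows "P dvd x \<longleftrightarrow> poly x t = 0"
proof -
  obtain e p where P: "P = [:e, p:]" "p \<noteq> 0"
    using assms(1) by (metis degree1_coeffs)
  then have "e = - (t * p)" using assms(2) by (simp add: add_eq_0_iff2)
  then have "P = smult p [:- t, 1:]" using P by simp
  then show ?thesis using P(2) by (metis smult_dvd_iff poly_eq_0_iff_dvd)
qed

text \<open>The coset of \<open>hecke_rep P z\<close> is determined by the kernel of its reduction at the root
  \<open>t\<close> of \<open>P\<close>, that is, by a point of the projective line over the finite field, on which
  \<open>\<gamma>\<close> acts by right multiplication of row vectors.\<close>

lemma hecke_rep_cosets:
  fixes P :: "'a::{finite,field} poly"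
  assumes deg: "degree P = 1" and P0: "poly P 0 = 1" and \<gamma>: "Gamma1T \<gamma>"
  obtains \<sigma> \<gamma>' where "bij \<sigma>" "\<And>z. Gamma1T (\<gamma>' z)"
    "\<And>z. m2mul (hecke_rep P z) \<gamma> = m2mul (\<gamma>' z) (hecke_rep P (\<sigma> z))"
proof -
  obtain e p where "P = [:e, p:]" "p \<noteq> 0"
    using deg by (metis degree1_coeffs)
  then have P: "P = [:1, p:]" "p \<noteq> 0" using P0 by auto
  define t where "t = - 1 / p"
  have Pt: "poly P t = 0" using P by (simp add: t_def)
  note dvd = linear_dvd_iff_root[OF deg Pt]
  have P_nz: "P \<noteq> 0" using deg by auto
  obtain a b c d where \<gamma>_eq: "\<gamma> = M2 a b c d" by (cases \<gamma>)
  have \<gamma>0: "poly a 0 = 1" "poly d 0 = 1" "poly c 0 = 0" and det: "a * d - b * c = 1"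
    using \<gamma> by (simp_all add: \<gamma>_eq Gamma1T_iff)
  define A B C D where ABCD: "A = poly a t" "B = poly b t" "C = poly c t" "D = poly d t"
  have det_t: "A * D - B * C = 1"
    using arg_cong[OF det, of "\<lambda>x. poly x t"] by (simp add: ABCD)
  \<comment> \<open>At \<open>t\<close> the only nonzero row of the representative is (0, 1) for
    \<open>None\<close> and (1, u) for \<open>Some u\<close>. Times the reduction of \<gamma> these
    become (C, D) and (A + uC, B + uD), which are rescaled to first coordinate 1 unless that
    coordinate vanishes.\<close>
  define \<sigma> where "\<sigma> z = (case z of
      None \<Rightarrow> if C = 0 then None else Some (D / C)
    | Some u \<Rightarrow> if A + u * C = 0 then None else Some ((B + u * D) / (A + u * C)))" for z
  have "inj \<sigma>"
  proof (rule injI)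
    fix z z' assume eq: "\<sigma> z = \<sigma> z'"
    have *: "u = v" if "\<sigma> (Some u) = \<sigma> (Some v)" for u v
    proof (cases "A + u * C = 0")
      case True
      then have "A + v * C = 0" using that by (auto simp: \<sigma>_def split: if_splits)
      then have "(u - v) * C = 0" using True by algebra
      moreover have "C \<noteq> 0" using True det_t by auto
      ultimately show ?thesis by simp
    next
      case False
      then have "A + v * C \<noteq> 0" "(B + u * D) / (A + u * C) = (B + v * D) / (A + v * C)"
        using that by (auto simp: \<sigma>_def split: if_splits)
      then have "(B + u * D) * (A + v * C) = (B + v * D) * (A + u * C)"
        using False by (simp add: divide_simps)
      then have "(u - v) * (A * D - B * C) = 0" by algebra
      then show ?thesis using det_t by simp
    qed
    have **: "\<sigma> None \<noteq> \<sigma> (Some u)" for u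
    proof
      assume eq: "\<sigma> None = \<sigma> (Some u)"
      show False
      proof (cases "C = 0")
        case True
        then have "A + u * C = 0" using eq by (auto simp: \<sigma>_def split: if_splits)
        then show False using True det_t by simp
      next
        case False
        then have "A + u * C \<noteq> 0" "D / C = (B + u * D) / (A + u * C)"
          using eq by (auto simp: \<sigma>_def split: if_splits)
        then have "D * (A + u * C) = (B + u * D) * C" using False by (simp add: divide_simps)
        then have "A * D - B * C = 0" by algebra
        then show False using det_t by simp
      qed
    qed
    show "z = z'"
      using eq * **[of "the z"] **[of "the z'"] by (cases z; cases z') auto
  qed
  then have "bij \<sigma>" by (simp add: bij_betw_def finite_UNIV_inj_surj)
  \<comment> \<open>In each case \<open>g\<close> is found by solving the equation for it. Exactly
    one entry of the solution then has denominator \<open>P\<close>; the choice of \<sigma> makes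
    its numerator vanish at \<open>t\<close>, and \<open>y\<close> is the resulting quotient. Since
    \<open>P\<close> is 1 at 0, dividing by it keeps the congruences modulo T.\<close>
  moreover have "\<exists>g. Gamma1T g \<and> m2mul (hecke_rep P z) \<gamma> = m2mul g (hecke_rep P (\<sigma> z))" for z
  proof (cases z)
    case None
    show ?thesis
    proof (cases "C = 0")
      case True
      then have "P dvd c" by (simp add: dvd ABCD)
      then obtain y where y: "c = P * y" by (elim dvdE)
      then have "poly y 0 = 0" using \<gamma>0 P0 by simp
      then have "Gamma1T (M2 a (P * b) y d)"
        using \<gamma>0 det y by (simp add: Gamma1T_iff algebra_simps)
      moreover have "\<sigma> z = None" using None True by (simp add: \<sigma>_def)
      ultimately show ?thesis using None y
        by (intro exI[of _ "M2 a (P * b) y d"]) (simp add: \<gamma>_eq algebra_simps)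
    next
      case False
      define s where "s = [:D / C:] * (1 - P)"
      have rep: "hecke_rep P (Some (D / C)) = M2 1 s 0 P" by (simp add: s_def)
      have st: "poly s t = D / C" "poly s 0 = 0" using Pt P0 by (simp_all add: s_def)
      have "P dvd d - s * c" using False by (simp add: dvd st flip: ABCD)
      then obtain y where y: "d - s * c = P * y" by (elim dvdE)
      then have "poly (d - s * c) 0 = poly (P * y) 0" by (simp only:)
      then have "poly y 0 = 1" using \<gamma>0 P0 st by simp
      moreover have "P * a * y - (b - s * a) * c = 1"
      proof -
        have "P * a * y - (b - s * a) * c = a * (P * y) - (b - s * a) * c"
          by (simp add: algebra_simps)
        also have "\<dots> = a * d - b * c" by (simp add: algebra_simps flip: y)
        finally show ?thesis using det by simp
      qed
      ultimately have "Gamma1T (M2 (P * a) (b - s * a) c y)"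
        using \<gamma>0 P0 by (simp add: Gamma1T_iff)
      moreover have "\<sigma> z = Some (D / C)" using None False by (simp add: \<sigma>_def)
      moreover have "d = s * c + y * P" using y by (simp add: algebra_simps)
      ultimately show ?thesis using None
        by (intro exI[of _ "M2 (P * a) (b - s * a) c y"])
           (simp add: \<gamma>_eq rep algebra_simps del: hecke_rep.simps(2))
    qed
  next
    case (Some u)
    define r where "r = [:u:] * (1 - P)"
    have rep: "hecke_rep P (Some u) = M2 1 r 0 P" by (simp add: r_def)
    have rt: "poly r t = u" "poly r 0 = 0" using Pt P0 by (simp_all add: r_def)
    show ?thesis
    proof (cases "A + u * C = 0")
      case True
      then have "P dvd a + r * c" by (simp add: dvd rt flip: ABCD)
      then obtain y where y: "a + r * c = P * y" by (elim dvdE)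
      then have "poly (a + r * c) 0 = poly (P * y) 0" by (simp only:)
      then have "poly y 0 = 1" using \<gamma>0 P0 rt by simp
      moreover have "y * (P * d) - (b + r * d) * c = 1"
      proof -
        have "y * (P * d) - (b + r * d) * c = (P * y) * d - (b + r * d) * c"
          by (simp add: algebra_simps)
        also have "\<dots> = a * d - b * c" by (simp add: algebra_simps flip: y)
        finally show ?thesis using det by simp
      qed
      ultimately have "Gamma1T (M2 y (b + r * d) c (P * d))"
        using \<gamma>0 P0 by (simp add: Gamma1T_iff)
      moreover have "\<sigma> z = None" using Some True by (simp add: \<sigma>_def)
      ultimately show ?thesis using Some y
        by (intro exI[of _ "M2 y (b + r * d) c (P * d)"])
           (simp add: \<gamma>_eq rep algebra_simps del: hecke_rep.simps(2))
    next
      case False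
      define v where "v = (B + u * D) / (A + u * C)"
      define s where "s = [:v:] * (1 - P)"
      have rep: "hecke_rep P (Some u) = M2 1 r 0 P" "hecke_rep P (Some v) = M2 1 s 0 P"
        by (simp_all add: r_def s_def)
      have st: "poly s t = v" "poly s 0 = 0" using Pt P0 by (simp_all add: s_def)
      have "P dvd b + r * d - s * (a + r * c)"
        using False by (simp add: dvd st rt v_def flip: ABCD)
      then obtain y where y: "b + r * d - s * (a + r * c) = P * y" by (elim dvdE)
      have "(a + r * c) * (d - s * c) - y * (P * c) = 1"
      proof -
        have "(a + r * c) * (d - s * c) - y * (P * c) = (a + r * c) * (d - s * c) - (P * y) * c"
          by (simp add: algebra_simps)
        also have "\<dots> = a * d - b * c" by (simp add: algebra_simps flip: y)
        finally show ?thesis using det by simp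
      qed
      then have "Gamma1T (M2 (a + r * c) y (P * c) (d - s * c))"
        using \<gamma>0 P0 rt st by (simp add: Gamma1T_iff)
      moreover have "\<sigma> z = Some v" using Some False by (simp add: \<sigma>_def v_def)
      moreover have "b + r * d = s * (a + r * c) + y * P" using y by (simp add: algebra_simps)
      ultimately show ?thesis using Some
        by (intro exI[of _ "M2 (a + r * c) y (P * c) (d - s * c)"])
           (simp add: \<gamma>_eq rep algebra_simps del: hecke_rep.simps(2))
    qed
  qed
  then obtain \<gamma>' where "\<And>z. Gamma1T (\<gamma>' z)"
      "\<And>z. m2mul (hecke_rep P z) \<gamma> = m2mul (\<gamma>' z) (hecke_rep P (\<sigma> z))"
    by metis
  ultimately show ?thesis using that by blast
qed

section \<open>The Hecke operator on cocycles for P = 1 + pT\<close>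

locale hecke_setting = fls_embedding \<iota> for \<iota> :: "'a::{finite,field} fls \<Rightarrow> 'c::field" +
  fixes P :: "'a poly" and k :: nat and m :: int and c :: "'a fls m2 \<Rightarrow> nat \<Rightarrow> 'c"
    and p :: 'a
  assumes P_eq: "P = [:1, p:]" and p_nz: "p \<noteq> 0" and cocycle: "hcocycle k m \<iota> c"
begin

abbreviation "H z \<equiv> m2map polyK (hecke_rep P z)"

lemma degP: "degree P = 1" and P0: "poly P 0 = 1"
  using p_nz by (simp_all add: P_eq)

lemma polyK_P: "polyK P = 1 + fls_const p * fls_X_inv"
  by (simp add: P_eq polyK_pCons mult.commute)

lemma polyK_P_nz: "polyK P \<noteq> 0"
proof
  assume "polyK P = 0"
  then have "fls_nth (polyK P) 0 = 0" by simp
  then show False by (simp add: polyK_P)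
qed

lemma cocycle_class: "m2det g \<noteq> 0 \<Longrightarrow> t \<noteq> 0 \<Longrightarrow> iwahori h \<Longrightarrow> c (m2mul (m2scale t g) h) = c g"
  and cocycle_flip: "m2det g \<noteq> 0 \<Longrightarrow> c (m2mul g wmat) = (\<lambda>j. - c g j)"
  and cocycle_harmonic: "m2det g \<noteq> 0 \<Longrightarrow>
        c g j + (\<Sum>u\<in>UNIV. c (m2mul g (M2 (fls_const u) 1 1 0)) j) = 0"
  and cocycle_equivariant: "Gamma1T \<gamma> \<Longrightarrow> m2det g \<noteq> 0 \<Longrightarrow>
        c (m2mul (m2map polyK \<gamma>) g) = act k m \<iota> (m2map polyK \<gamma>) (c g)"
  using cocycle unfolding hcocycle_def by blast+

lemma H_det: "m2det (H z) = polyK P"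
  by (cases z) simp_all

lemma hecke_eq_sum:
  "hecke k m \<iota> P c g j = \<iota> (polyK P) powi (int k - m - 1) *
     (\<Sum>z\<in>UNIV. act k m \<iota> (m2inv (H z)) (c (m2mul (H z) g)) j)"
  by (simp add: hecke_def UNIV_option_conv sum.reindex Let_def)

text \<open>Moving \<gamma> past a representative turns it into \<gamma>' on the left, where
  equivariance of \<open>c\<close> applies; the inverse representative turns \<gamma>' back into
  \<gamma>, and the bijection \<sigma> reindexes the sum.\<close>

lemma hecke_equivariant:
  assumes \<gamma>: "Gamma1T \<gamma>" and g: "m2det g \<noteq> 0"
  shows "hecke k m \<iota> P c (m2mul (m2map polyK \<gamma>) g)
       = act k m \<iota> (m2map polyK \<gamma>) (hecke k m \<iota> P c g)"
proof
  fix j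
  obtain \<sigma> \<gamma>' where bij: "bij \<sigma>" and \<gamma>': "\<And>z. Gamma1T (\<gamma>' z)"
    and eq: "\<And>z. m2mul (hecke_rep P z) \<gamma> = m2mul (\<gamma>' z) (hecke_rep P (\<sigma> z))"
    using hecke_rep_cosets[OF degP P0 \<gamma>] by blast
  let ?\<gamma> = "m2map polyK \<gamma>"
  have Hdet: "m2det (H z) \<noteq> 0" for z using polyK_P_nz by (simp add: H_det)
  have eqK: "m2mul (H z) ?\<gamma> = m2mul (m2map polyK (\<gamma>' z)) (H (\<sigma> z))" for z
    by (simp only: eq flip: m2map_polyK_mult)
  have inv: "m2mul (m2inv (H z)) (m2map polyK (\<gamma>' z)) = m2mul ?\<gamma> (m2inv (H (\<sigma> z)))" for z
  proof -
    have "m2mul (m2inv (H z)) (m2map polyK (\<gamma>' z)) =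
      m2mul (m2inv (H z)) (m2mul (m2mul (m2map polyK (\<gamma>' z)) (H (\<sigma> z))) (m2inv (H (\<sigma> z))))"
      using Hdet by (simp add: m2mul_assoc m2mul_inv_left)
    also have "\<dots> = m2mul (m2mul (m2inv (H z)) (H z)) (m2mul ?\<gamma> (m2inv (H (\<sigma> z))))"
      by (simp only: m2mul_assoc flip: eqK)
    finally show ?thesis using Hdet by (simp add: m2mul_inv_left)
  qed
  have act_term: "act k m \<iota> (m2inv (H z)) (c (m2mul (H z) (m2mul ?\<gamma> g))) =
     act k m \<iota> ?\<gamma> (act k m \<iota> (m2inv (H (\<sigma> z))) (c (m2mul (H (\<sigma> z)) g)))" for z
  proof -
    have "c (m2mul (H z) (m2mul ?\<gamma> g)) = c (m2mul (m2map polyK (\<gamma>' z)) (m2mul (H (\<sigma> z)) g))"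
      by (simp only: eqK flip: m2mul_assoc)
    also have "\<dots> = act k m \<iota> (m2map polyK (\<gamma>' z)) (c (m2mul (H (\<sigma> z)) g))"
      using \<gamma>' Hdet g by (intro cocycle_equivariant) (auto simp: m2det_mult)
    finally show ?thesis by (simp only: act_act inv)
  qed
  have "hecke k m \<iota> P c (m2mul ?\<gamma> g) j = \<iota> (polyK P) powi (int k - m - 1) *
     (\<Sum>z\<in>UNIV. act k m \<iota> ?\<gamma> (act k m \<iota> (m2inv (H (\<sigma> z))) (c (m2mul (H (\<sigma> z)) g))) j)"
    by (simp only: hecke_eq_sum act_term)
  also have "\<dots> = \<iota> (polyK P) powi (int k - m - 1) *
     (\<Sum>z\<in>UNIV. act k m \<iota> ?\<gamma> (act k m \<iota> (m2inv (H z)) (c (m2mul (H z) g))) j)"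
    by (simp only: sum.reindex_bij_betw[OF bij,
        of "\<lambda>z. act k m \<iota> ?\<gamma> (act k m \<iota> (m2inv (H z)) (c (m2mul (H z) g))) j"])
  also have "\<dots> = act k m \<iota> ?\<gamma> (hecke k m \<iota> P c g) j"
    by (simp only: hecke_eq_sum[abs_def] act_scale act_sum)
  finally show "hecke k m \<iota> P c (m2mul ?\<gamma> g) j = act k m \<iota> ?\<gamma> (hecke k m \<iota> P c g) j" .
qed

text \<open>Constancy on edges, reversal and harmonicity concern right multiplication, while the
  representatives multiply from the left, so these conditions pass through the sum termwise. Only
  equivariance requires the permutation of cosets.\<close>

lemma hcocycle_hecke: "hcocycle k m \<iota> (hecke k m \<iota> P c)"
proof -
  have Hg: "m2det (m2mul (H z) g) \<noteq> 0" if "m2det g \<noteq> 0" for z g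
    using that polyK_P_nz by (simp add: m2det_mult H_det)
  have "hecke k m \<iota> P c g j = 0" if "k - 2 < j" for g j
    using that by (simp add: hecke_eq_sum act_gt)
  moreover have "hecke k m \<iota> P c (m2mul (m2scale t g) h) = hecke k m \<iota> P c g"
    if "m2det g \<noteq> 0" "t \<noteq> 0" "iwahori h" for g t h
  proof -
    have "c (m2mul (H z) (m2mul (m2scale t g) h)) = c (m2mul (H z) g)" for z
      using cocycle_class[OF Hg[OF that(1)] that(2,3), of z]
      by (simp add: m2mul_scale_right flip: m2mul_assoc)
    then show ?thesis by (intro ext) (simp only: hecke_eq_sum)
  qed
  moreover have "hecke k m \<iota> P c (m2mul g wmat) = (\<lambda>j. - hecke k m \<iota> P c g j)"
    if "m2det g \<noteq> 0" for g
  proof -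
    have "c (m2mul (H z) (m2mul g wmat)) = (\<lambda>j. - c (m2mul (H z) g) j)" for z
      using cocycle_flip[OF Hg[OF that(1)], of z] by (simp add: m2mul_assoc)
    then show ?thesis by (intro ext) (simp add: hecke_eq_sum act_minus sum_negf)
  qed
  moreover have "hecke k m \<iota> P c g j
      + (\<Sum>u\<in>UNIV. hecke k m \<iota> P c (m2mul g (M2 (fls_const u) 1 1 0)) j) = 0"
    if "m2det g \<noteq> 0" for g j
  proof -
    have "(\<lambda>j. \<Sum>u\<in>UNIV. c (m2mul (H z) (m2mul g (M2 (fls_const u) 1 1 0))) j)
        = (\<lambda>j. - c (m2mul (H z) g) j)" for z
      using cocycle_harmonic[OF Hg[OF that], of z]
      by (intro ext) (simp add: m2mul_assoc eq_neg_iff_add_eq_0 add.commute)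
    note harm = this
    have "(\<Sum>u\<in>UNIV. hecke k m \<iota> P c (m2mul g (M2 (fls_const u) 1 1 0)) j) =
      \<iota> (polyK P) powi (int k - m - 1) * (\<Sum>z\<in>UNIV. \<Sum>u\<in>UNIV. act k m \<iota> (m2inv (H z))
          (c (m2mul (H z) (m2mul g (M2 (fls_const u) 1 1 0)))) j)"
      by (simp only: hecke_eq_sum flip: sum_distrib_left) (subst sum.swap, rule refl)
    also have "\<dots> = - hecke k m \<iota> P c g j"
      by (simp only: harm act_minus flip: act_sum) (simp add: hecke_eq_sum sum_negf)
    finally show ?thesis by simp
  qed
  ultimately show ?thesis
    using hecke_equivariant unfolding hcocycle_def by blast
qed

end

lemma fls_X_mult_X_inv [simp]: "fls_X * fls_X_inv = (1 :: 'a::field fls)"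
  by (metis fls_inverse_X fls_X_nonzero right_inverse)

lemma fls_X_mult_X_inv_left [simp]: "fls_X * (fls_X_inv * z) = (z :: 'a::field fls)"
  by (simp flip: mult.assoc)

section \<open>Cocycle values on the edges near \<open>gamma0\<close>\<close>

context hecke_setting
begin

abbreviation "T \<equiv> fls_X_inv :: 'a fls"
abbreviation "Pf \<equiv> polyK P"
abbreviation "w \<equiv> c gamma0"

text \<open>Two matrices represent the same edge as soon as a scalar \<open>t\<close> and an Iwahori
  matrix \<open>h'\<close> link them; the edge computations below consist of exhibiting such a
  pair.\<close>

lemma cocycle_eqI:
  assumes "m2det g \<noteq> 0" "m2det g' \<noteq> 0" "t \<noteq> 0" "iwahori h'"
    "m2scale t g = m2mul g' h'"
  shows "c g = c g'"
proof -
  have "iwahori (M2 1 0 0 1 :: 'a fls m2)" by (simp add: iwahori_def inO_def inPO_def unitO_def)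
  from cocycle_class[OF assms(1,3) this] have "c g = c (m2mul g' h')" by (simp add: assms(5))
  also have "\<dots> = c g'"
    using cocycle_class[OF assms(2) _ assms(4), of 1] by (cases g') simp
  finally show ?thesis .
qed

lemma subdegree_X_plus_const:
  assumes "a \<noteq> 0"
  shows "fls_subdegree (fls_X + fls_const a :: 'a fls) = 0" "fls_X + fls_const a \<noteq> (0 :: 'a fls)"
proof -
  show "fls_subdegree (fls_X + fls_const a) = 0"
    by (rule fls_subdegree_eqI) (use assms in auto)
  have "fls_nth (fls_X + fls_const a) 0 = a" by simp
  then show "fls_X + fls_const a \<noteq> 0" using assms by force
qed

text \<open>\<open>Pf\<close> has a simple pole at infinity, so this product with the uniformiser is
  a unit of the valuation ring. It is, up to sign, the determinant of the Iwahori matrices chosen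
  below for the representatives.\<close>

lemma X_mult_Pf: "fls_X * Pf = fls_X + fls_const p"
  by (simp add: polyK_P algebra_simps)

text \<open>In the harmonic relation at the identity, \<open>M2 (fls_const u) 1 1 0\<close> is the
  translate of \<open>gamma0\<close> by an upper unipotent element of \<Gamma>_1(T).\<close>

lemma cocycle_one: "c (M2 1 0 0 1) j = - (\<Sum>u\<in>UNIV. act k m \<iota> (M2 1 (fls_const u) 0 1) w j)"
proof -
  have "c (M2 (fls_const u) 1 1 0) = act k m \<iota> (M2 1 (fls_const u) 0 1) w" for u
    using cocycle_equivariant[of "M2 1 [:u:] 0 1" gamma0]
    by (simp add: Gamma1T_iff gamma0_def polyK_pCons)
  then show ?thesis
    using cocycle_harmonic[of "M2 1 0 0 1" j] by (simp add: eq_neg_iff_add_eq_0)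
qed

text \<open>This edge is that of \<open>wmat\<close>, the reverse of the edge of the identity, so
  the two minus signs cancel.\<close>

lemma cocycle_infinity:
  "c (m2mul (M2 Pf 0 0 1) gamma0) j = (\<Sum>u\<in>UNIV. act k m \<iota> (M2 1 (fls_const u) 0 1) w j)"
proof -
  have "c (m2mul (M2 Pf 0 0 1) gamma0) = c wmat"
    by (rule cocycle_eqI[where t = fls_X and h' = "M2 1 0 0 (fls_X * Pf)"])
       (use subdegree_X_plus_const[OF p_nz] in \<open>auto simp: gamma0_def wmat_def X_mult_Pf
          iwahori_def inO_def inPO_def unitO_def polyK_P_nz\<close>)
  also have "c wmat = (\<lambda>j. - c (M2 1 0 0 1) j)"
    using cocycle_flip[of "M2 1 0 0 1"] by simp
  finally show ?thesis by (simp add: cocycle_one)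
qed

text \<open>The product of \<open>gamma0\<close> and \<open>wmat\<close> is this diagonal matrix, so
  its edge is the reverse of \<open>gamma0\<close>.\<close>

lemma cocycle_diag_X: "c (M2 fls_X 0 0 1) = (\<lambda>j. - w j)"
  using cocycle_flip[of gamma0] by (simp add: gamma0_def wmat_def)

text \<open>For \<open>u \<noteq> 0\<close> the matrix \<open>M2 (fls_const u) 1 1 0\<close> is
  lower unipotent times upper triangular. The upper factor is Iwahori; conjugating the lower one by
  the diagonal matrix divides its entry by \<open>fls_X\<close>, which places it in
  \<Gamma>_1(T).\<close>

lemma cocycle_diag_X_neighbour:
  assumes "u \<noteq> 0"
  shows "c (m2mul (M2 fls_X 0 0 1) (M2 (fls_const u) 1 1 0)) j =
     - act k m \<iota> (M2 1 0 (fls_const (inverse u) * T) 1) w j"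
proof -
  have "c (m2mul (M2 fls_X 0 0 1) (M2 (fls_const u) 1 1 0)) = c (M2 fls_X 0 (fls_const (inverse u)) 1)"
    by (rule cocycle_eqI[where t = 1 and h' = "M2 (fls_const u) 1 0 (- fls_const (inverse u))"])
       (use assms in \<open>auto simp: iwahori_def inO_def inPO_def unitO_def\<close>)
  also have "\<dots> = act k m \<iota> (M2 1 0 (fls_const (inverse u) * T) 1) (c (M2 fls_X 0 0 1))"
    using cocycle_equivariant[of "M2 1 0 [:0, inverse u:] 1" "M2 fls_X 0 0 1"]
    by (simp add: Gamma1T_iff polyK_pCons mult_ac)
  finally show ?thesis by (simp add: cocycle_diag_X act_minus)
qed

text \<open>This edge is the member \<open>u = 0\<close> of the harmonic relation at
  \<open>M2 fls_X 0 0 1\<close>. The other members are lower unipotent translates, and the edge of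
  that matrix itself, the reverse of \<open>gamma0\<close>, supplies the summand
  \<open>x = 0\<close>.\<close>

lemma cocycle_zero:
  "c (m2mul (H (Some 0)) gamma0) j = (\<Sum>x\<in>UNIV. act k m \<iota> (M2 1 0 (fls_const x * T) 1) w j)"
proof -
  let ?f = "\<lambda>u. c (m2mul (M2 fls_X 0 0 1) (M2 (fls_const u) 1 1 0)) j"
  let ?g = "\<lambda>x. act k m \<iota> (M2 1 0 (fls_const x * T) 1) w j"
  have "c (m2mul (H (Some 0)) gamma0) = c (M2 0 fls_X 1 0)"
    by (rule cocycle_eqI[where t = fls_X and h' = "M2 (fls_X * Pf) 0 0 1"])
       (use subdegree_X_plus_const[OF p_nz] in \<open>auto simp: gamma0_def wmat_def X_mult_Pf
          iwahori_def inO_def inPO_def unitO_def polyK_P_nz\<close>)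
  then have "c (m2mul (H (Some 0)) gamma0) j = ?f 0" by simp
  also have "\<dots> = - c (M2 fls_X 0 0 1) j - (\<Sum>u\<in>UNIV - {0}. ?f u)"
  proof -
    have "m2det (M2 fls_X 0 0 1 :: 'a fls m2) \<noteq> 0" by simp
    from cocycle_harmonic[OF this, of j]
    have "c (M2 fls_X 0 0 1) j + (?f 0 + (\<Sum>u\<in>UNIV - {0}. ?f u)) = 0"
      by (simp only: sum.remove[of UNIV 0] finite UNIV_I)
    then show ?thesis by algebra
  qed
  also have "(\<Sum>u\<in>UNIV - {0}. ?f u) = - (\<Sum>u\<in>UNIV - {0}. ?g (inverse u))"
    unfolding sum_negf[symmetric] by (intro sum.cong refl cocycle_diag_X_neighbour) auto
  also have "(\<Sum>u\<in>UNIV - {0}. ?g (inverse u)) = (\<Sum>x\<in>UNIV - {0}. ?g x)"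
    by (rule sum.reindex_bij_witness[of _ inverse inverse]) auto
  \<comment> \<open>Equivariance under the identity matrix shows that it acts trivially on
    \<open>w\<close>.\<close>
  also have "- c (M2 fls_X 0 0 1) j = ?g 0"
    using cocycle_equivariant[of "M2 1 0 0 1" gamma0]
    by (simp add: cocycle_diag_X Gamma1T_iff gamma0_def)
  finally show ?thesis by (simp add: sum.remove[of UNIV 0])
qed

lemma cocycle_nonzero:
  assumes "u \<noteq> 0"
  shows "c (m2mul (H (Some u)) gamma0) j =
    - act k m \<iota> (M2 (2 - Pf) (- fls_const u) ((Pf - 1) * fls_const (inverse u)) 1) w j"
proof -
  define s where "s = fls_const p"
  define v where "v = fls_const u"
  define v' where "v' = fls_const (inverse u)"
  have vv': "v * v' = 1" using assms by (simp add: v_def v'_def)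
  have XT: "fls_X * T = 1" by simp
  let ?\<gamma> = "M2 [:1, - p:] [:- u:] [:0, p * inverse u:] 1"
  let ?G = "m2mul (M2 (1 - s * T) (- v) (s * v' * T) 1) (M2 fls_X 0 0 1)"
  have Pf: "Pf = 1 + s * T" by (simp add: polyK_P s_def)
  have \<gamma>: "m2map polyK ?\<gamma> = M2 (1 - s * T) (- v) (s * v' * T) 1"
    by (simp add: polyK_pCons v_def v'_def s_def mult_ac)
  have Gamma: "Gamma1T ?\<gamma>" using assms by (simp add: Gamma1T_iff one_pCons)
  have det: "(1 - s * T) * fls_X + v * (s * v' * T * fls_X) = fls_X"
    using vv' XT by algebra
  define y where "y = - s * v'"
  have y: "y = fls_const (- (p * inverse u))" by (simp add: y_def s_def v'_def)
  \<comment> \<open>The inverse of \<open>?\<gamma>\<close> takes the matrix on the left to one with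
    rows (v, 1) and (1, yT). Scaling by \<open>fls_X\<close> and splitting off
    \<open>M2 fls_X 0 0 1\<close> leaves the Iwahori factor \<open>M2 v 1 fls_X y\<close>.\<close>
  have "c (m2mul (H (Some u)) gamma0) = c ?G"
  proof (rule cocycle_eqI[where t = fls_X and h' = "M2 v 1 fls_X y"])
    have "m2det (M2 v 1 fls_X y) = - (fls_X + fls_const p)"
      unfolding m2det.simps using vv' s_def y_def by algebra
    then have "unitO (m2det (M2 v 1 fls_X y))"
      unfolding unitO_def using subdegree_X_plus_const[OF p_nz]
      by (simp only: fls_uminus_subdegree neg_equal_0_iff_equal not_False_eq_True simp_thms)
    then show "iwahori (M2 v 1 fls_X y)"
      by (auto simp: iwahori_def inO_def inPO_def v_def y simp del: m2det.simps)
    show "m2det (m2mul (H (Some u)) gamma0) \<noteq> 0"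
      by (simp only: m2det_mult H_det) (simp add: polyK_P_nz gamma0_def)
    show "m2det ?G \<noteq> 0" using det by simp
    have H: "H (Some u) = M2 1 (v * (1 - Pf)) 0 Pf"
      by (simp add: polyK_smult polyK_diff v_def)
    have "fls_X * (v * (1 - Pf)) = (1 - s * T) * fls_X * v - v * fls_X"
      "fls_X = (1 - s * T) * fls_X - v * y"
      "fls_X * Pf = s * v' * T * fls_X * v + fls_X"
      "0 = s * v' * T * fls_X + y"
      using vv' XT Pf y_def by algebra+
    then show "m2scale fls_X (m2mul (H (Some u)) gamma0) = m2mul ?G (M2 v 1 fls_X y)"
      by (simp only: H gamma0_def m2scale.simps m2mul.simps) simp
  qed simp
  also have "c ?G = act k m \<iota> (M2 (1 - s * T) (- v) (s * v' * T) 1) (c (M2 fls_X 0 0 1))"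
    using cocycle_equivariant[OF Gamma, of "M2 fls_X 0 0 1"] by (simp only: \<gamma>) simp
  also have "1 - s * T = 2 - Pf" by (simp add: Pf)
  also have "s * v' * T = (Pf - 1) * v'" by (simp add: Pf)
  finally show ?thesis by (simp add: cocycle_diag_X act_minus v_def v'_def)
qed

section \<open>The value of the Hecke image at \<open>gamma0\<close> as a pairing with a
  form\<close>

lemma act_normalised:
  assumes j: "j \<le> k - 2" and k: "k \<ge> 2" and det: "m2det g = inverse Pf"
  shows "\<iota> Pf powi (int k - m - 1) * act k m \<iota> g w j =
     pair (k - 2) w ([:Pf * mb g, Pf * ma g:] ^ j * [:Pf * md g, Pf * mc g:] ^ (k - 2 - j))"
proof -
  have nz: "\<iota> Pf \<noteq> 0" by (simp add: map_nonzero polyK_P_nz)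
  \<comment> \<open>The exponents k - m - 1 and m - 1 add up to k - 2, so the type disappears and
    each of the k - 2 linear factors receives one \<open>Pf\<close>, which clears the denominators
    of the inverse representatives.\<close>
  have "\<iota> Pf powi (int k - m - 1) * \<iota> (m2det g) powi (1 - m)
      = \<iota> Pf powi (int k - m - 1) * \<iota> Pf powi (- (1 - m))"
    by (simp only: det map_inverse power_int_minus power_int_inverse)
  also have "\<dots> = \<iota> Pf powi int (k - 2)"
    unfolding power_int_add[OF disjI1[OF nz], symmetric]
    by (rule arg_cong[where f = "\<lambda>z. \<iota> Pf powi z"]) (use k in \<open>simp add: of_nat_diff\<close>)
  also have "\<dots> = \<iota> (Pf ^ j * Pf ^ (k - 2 - j))"
    using j by (simp only: power_int_of_nat le_add_diff_inverse map_power flip: power_add)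
  finally have "\<iota> Pf powi (int k - m - 1) * \<iota> (m2det g) powi (1 - m) = \<iota> (Pf ^ j * Pf ^ (k - 2 - j))" .
  then have "\<iota> Pf powi (int k - m - 1) * act k m \<iota> g w j =
      pair (k - 2) w (smult (Pf ^ j * Pf ^ (k - 2 - j))
        ([:mb g, ma g:] ^ j * [:md g, mc g:] ^ (k - 2 - j)))"
    by (simp add: act_eq_pair[OF j] pair_smult flip: mult.assoc)
  also have "smult (Pf ^ j * Pf ^ (k - 2 - j)) ([:mb g, ma g:] ^ j * [:md g, mc g:] ^ (k - 2 - j))
     = smult Pf [:mb g, ma g:] ^ j * smult Pf [:md g, mc g:] ^ (k - 2 - j)"
    by (simp only: smult_power mult_smult_left mult_smult_right smult_smult mult.commute)
  finally show ?thesis by simp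
qed

text \<open>The three sums come from the representatives \<open>None\<close>, \<open>Some 0\<close>
  and \<open>Some u\<close> with \<open>u \<noteq> 0\<close>; the last is subtracted because those
  edges are reversed translates of \<open>gamma0\<close>.\<close>

definition hecke_form :: "nat \<Rightarrow> 'a fls poly" where
  "hecke_form j =
     (\<Sum>u\<in>UNIV. [:fls_const u, 1:] ^ j * [:Pf:] ^ (k - 2 - j))
   + (\<Sum>x\<in>UNIV. [:0, Pf:] ^ j * [:1, fls_const x * T:] ^ (k - 2 - j))
   - (\<Sum>u\<in>UNIV - {0}. [:fls_const u, 1:] ^ j * [:1, (1 - Pf) * fls_const (inverse u):] ^ (k - 2 - j))"

lemma hecke_gamma0:
  assumes j: "j \<le> k - 2" and k: "k \<ge> 2"
  shows "hecke k m \<iota> P c gamma0 j = pair (k - 2) w (hecke_form j)"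
proof -
  let ?e = "\<iota> Pf powi (int k - m - 1)"
  let ?n = "k - 2"
  let ?t = "\<lambda>z. ?e * act k m \<iota> (m2inv (H z)) (c (m2mul (H z) gamma0)) j"
  have "hecke k m \<iota> P c gamma0 j = ?t None + (\<Sum>u\<in>UNIV. ?t (Some u))"
    by (simp only: hecke_eq_sum)
       (simp add: UNIV_option_conv sum.reindex sum_distrib_left algebra_simps)
  also have "(\<Sum>u\<in>UNIV. ?t (Some u)) = ?t (Some 0) + (\<Sum>u\<in>UNIV - {0}. ?t (Some u))"
    by (subst sum.remove[of UNIV 0]) auto
  also have "?t None = (\<Sum>u\<in>UNIV. pair ?n w ([:fls_const u, 1:] ^ j * [:Pf:] ^ (?n - j)))"
  proof -
    have "c (m2mul (H None) gamma0) = (\<lambda>j. \<Sum>u\<in>UNIV. act k m \<iota> (M2 1 (fls_const u) 0 1) w j)"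
      by (intro ext) (simp only: cocycle_infinity hecke_rep.simps m2map.simps polyK_0 polyK_1)
    moreover have "?e * act k m \<iota> (m2mul (m2inv (H None)) (M2 1 (fls_const u) 0 1)) w j
        = pair ?n w ([:fls_const u, 1:] ^ j * [:Pf:] ^ (?n - j))" for u
      by (subst act_normalised[OF j k])
         (simp_all add: m2det_mult m2det_inv H_det polyK_P_nz, simp_all add: polyK_P_nz divide_simps)
    ultimately show ?thesis by (simp only: act_sum act_act sum_distrib_left)
  qed
  also have "?t (Some 0) =
    (\<Sum>x\<in>UNIV. pair ?n w ([:0, Pf:] ^ j * [:1, fls_const x * T:] ^ (?n - j)))"
  proof -
    have "c (m2mul (H (Some 0)) gamma0) =
        (\<lambda>j. \<Sum>x\<in>UNIV. act k m \<iota> (M2 1 0 (fls_const x * T) 1) w j)"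
      by (intro ext) (simp only: cocycle_zero)
    moreover have "?e * act k m \<iota> (m2mul (m2inv (H (Some 0))) (M2 1 0 (fls_const x * T) 1)) w j
        = pair ?n w ([:0, Pf:] ^ j * [:1, fls_const x * T:] ^ (?n - j))" for x
      by (subst act_normalised[OF j k])
         (simp_all add: m2det_mult m2det_inv H_det polyK_P_nz, simp_all add: polyK_P_nz divide_simps)
    ultimately show ?thesis by (simp only: act_sum act_act sum_distrib_left)
  qed
  also have "(\<Sum>u\<in>UNIV - {0}. ?t (Some u)) = (\<Sum>u\<in>UNIV - {0}. - pair ?n w
       ([:- fls_const u, 1:] ^ j * [:1, (Pf - 1) * fls_const (inverse u):] ^ (?n - j)))"
  proof (rule sum.cong[OF refl])
    fix u :: 'a assume "u \<in> UNIV - {0}"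
    then have u: "u \<noteq> 0" by simp
    let ?g = "M2 (2 - Pf) (- fls_const u) ((Pf - 1) * fls_const (inverse u)) 1"
    let ?g' = "m2mul (m2inv (H (Some u))) ?g"
    have c_eq: "c (m2mul (H (Some u)) gamma0) = (\<lambda>j. - act k m \<iota> ?g w j)"
      by (intro ext) (simp only: cocycle_nonzero[OF u])
    have uu: "fls_const u * fls_const (inverse u) = 1" using u by simp
    have "m2det ?g = 1" unfolding m2det.simps using uu by algebra
    then have det: "m2det ?g' = inverse Pf"
      by (simp only: m2det_mult m2det_inv H_det polyK_P_nz not_False_eq_True) simp
    have inv: "m2inv (H (Some u)) = M2 1 (- (fls_const u * (1 - Pf)) / Pf) 0 (1 / Pf)"
      using polyK_P_nz by (simp add: polyK_smult polyK_diff)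
    have entries: "Pf * ma ?g' = 1" "Pf * mb ?g' = - fls_const u"
      "Pf * mc ?g' = (Pf - 1) * fls_const (inverse u)" "Pf * md ?g' = 1"
    proof -
      \<comment> \<open>Since \<open>u\<close> and its inverse cancel, the right-hand side is
        \<open>Pf * (2 - Pf) + (1 - Pf) ^ 2\<close>, which is 1.\<close>
      have "Pf * ma ?g' = Pf * (2 - Pf) - (fls_const u * (1 - Pf)) * ((Pf - 1) * fls_const (inverse u))"
        unfolding inv using polyK_P_nz by (simp add: field_simps)
      also have "\<dots> = 1" using uu by algebra
      finally show "Pf * ma ?g' = 1" .
      show "Pf * mb ?g' = - fls_const u"
        unfolding inv using polyK_P_nz by (simp add: field_simps)
    qed (use polyK_P_nz in \<open>simp_all add: inv\<close>)
    show "?t (Some u) = - pair ?n w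
       ([:- fls_const u, 1:] ^ j * [:1, (Pf - 1) * fls_const (inverse u):] ^ (?n - j))"
      by (simp only: c_eq act_minus act_act mult_minus_right act_normalised[OF j k det] entries)
  qed
  \<comment> \<open>Replacing \<open>u\<close> by \<open>- u\<close> turns \<open>Pf - 1\<close>
    into \<open>1 - Pf\<close>, the quantity whose powers occur in the matrix entries.\<close>
  also have "\<dots> = (\<Sum>u\<in>UNIV - {0}. - pair ?n w
       ([:fls_const u, 1:] ^ j * [:1, (1 - Pf) * fls_const (inverse u):] ^ (?n - j)))"
    by (rule sum.reindex_bij_witness[of _ uminus uminus]) (auto simp: algebra_simps)
  finally show ?thesis
    by (simp add: hecke_form_def pair_add pair_minus pair_sum sum_negf
         flip: add_uminus_conv_diff)
qed

end

subsection \<open>The coefficients of the Hecke matrix\<close>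

lemma fls_const_sum: "fls_const (sum f A) = (\<Sum>x\<in>A. fls_const (f x))"
  by (induction A rule: infinite_finite_induct) (simp_all flip: fls_plus_const)

context hecke_setting
begin

text \<open>In the first two sums the coefficient carries the power sums with exponents j - r and r
  - j, which vanish for r = j. In the third, the l-th term contains u to the power j - (r - l) - l =
  j - r, the same for all \<open>l\<close>, so one power sum over the nonzero elements factors out;
  its value -1 cancels the minus sign of that sum.\<close>

lemma coeff_hecke_form:
  assumes j: "j \<le> k - 2"
  shows "coeff (hecke_form j) r =
     (if r < j \<and> (CARD('a) - 1) dvd (j - r) then - (of_nat (j choose r) * Pf ^ (k - 2 - j)) else 0)
   + (if j < r \<and> (CARD('a) - 1) dvd (r - j)
        then - (Pf ^ j * of_nat ((k - 2 - j) choose (r - j)) * T ^ (r - j)) else 0)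
   + (if int (CARD('a) - 1) dvd int j - int r
        then (\<Sum>l\<le>r. of_nat ((k - 2 - j) choose l) * of_nat (j choose (r - l)) * (1 - Pf) ^ l)
        else 0)"
proof -
  let ?n = "k - 2 - j"
  have const_power_sum: "(\<Sum>u\<in>UNIV. fls_const (u :: 'a) ^ n) =
      (if n > 0 \<and> (CARD('a) - 1) dvd n then - 1 else 0)" for n
    by (simp add: sum_power_UNIV flip: fls_const_power fls_const_sum)
  have 1: "coeff (\<Sum>u\<in>UNIV. [:fls_const (u :: 'a), 1:] ^ j * [:Pf:] ^ ?n) r =
     (if r < j \<and> (CARD('a) - 1) dvd (j - r) then - (of_nat (j choose r) * Pf ^ ?n) else 0)"
  proof -
    have "coeff (\<Sum>u\<in>UNIV. [:fls_const (u :: 'a), 1:] ^ j * [:Pf:] ^ ?n) r =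
       of_nat (j choose r) * Pf ^ ?n * (\<Sum>u\<in>UNIV. fls_const (u :: 'a) ^ (j - r))"
      by (simp add: coeff_sum poly_const_pow coeff_linear_poly_power' sum_distrib_left mult_ac)
    then show ?thesis by (simp add: const_power_sum)
  qed
  have monom: "[:0, Pf:] ^ j = monom (Pf ^ j) j"
    by (simp add: monom_altdef flip: smult_power)
  have 2: "coeff (\<Sum>x\<in>UNIV. [:0, Pf:] ^ j * [:1, fls_const (x :: 'a) * T:] ^ ?n) r =
     (if j < r \<and> (CARD('a) - 1) dvd (r - j)
        then - (Pf ^ j * of_nat (?n choose (r - j)) * T ^ (r - j)) else 0)"
  proof (cases "r < j")
    case True
    then show ?thesis by (simp add: coeff_sum monom coeff_monom_mult)
  next
    case False
    have "coeff (\<Sum>x\<in>UNIV. [:0, Pf:] ^ j * [:1, fls_const (x :: 'a) * T:] ^ ?n) r =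
       Pf ^ j * of_nat (?n choose (r - j)) * T ^ (r - j) * (\<Sum>x\<in>UNIV. fls_const (x :: 'a) ^ (r - j))"
      using False
      by (simp add: coeff_sum monom coeff_monom_mult coeff_linear_poly_power' sum_distrib_left
          sum_distrib_right power_mult_distrib mult_ac)
    then show ?thesis by (simp add: const_power_sum)
  qed
  have 3: "coeff (\<Sum>u\<in>UNIV - {0}.
        [:fls_const (u :: 'a), 1:] ^ j * [:1, (1 - Pf) * fls_const (inverse u):] ^ ?n) r =
     - (if int (CARD('a) - 1) dvd int j - int r
        then (\<Sum>l\<le>r. of_nat (?n choose l) * of_nat (j choose (r - l)) * (1 - Pf) ^ l)
        else 0)"
  proof -
    let ?s = "\<lambda>l. of_nat (?n choose l) * of_nat (j choose (r - l)) * (1 - Pf) ^ l :: 'a fls"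
    have "coeff ([:fls_const u, 1:] ^ j * [:1, (1 - Pf) * fls_const (inverse u):] ^ ?n) r =
       (\<Sum>l\<le>r. ?s l) * fls_const (u powi (int j - int r))" if u: "u \<noteq> 0" for u :: 'a
    proof -
      have "coeff ([:fls_const u, 1:] ^ j * [:1, (1 - Pf) * fls_const (inverse u):] ^ ?n) r =
        (\<Sum>l\<le>r. ?s l * fls_const (u ^ (j - (r - l)) * inverse u ^ l))"
        unfolding mult.commute[of "[:fls_const u, 1:] ^ j"] coeff_mult coeff_linear_poly_power'
        by (simp add: power_mult_distrib fls_const_power mult_ac flip: fls_const_mult_const)
      also have "\<dots> = (\<Sum>l\<le>r. ?s l * fls_const (u powi (int j - int r)))"
      proof (intro sum.cong refl)
        fix l assume l: "l \<in> {..r}"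
        show "?s l * fls_const (u ^ (j - (r - l)) * inverse u ^ l)
            = ?s l * fls_const (u powi (int j - int r))"
        \<comment> \<open>If \<open>r - l > j\<close>, truncated subtraction gives the wrong
          exponent, but then the binomial coefficient \<open>j choose (r - l)\<close> is
          zero.\<close>
        proof (cases "r - l \<le> j")
          case True
          have "u powi (int j - int r) * u ^ l = u ^ (j - (r - l))"
          proof -
            have "u powi (int j - int r) * u powi int l = u powi (int (j - (r - l)))"
              unfolding power_int_add[OF disjI1[OF u], symmetric]
              using True l by (simp add: of_nat_diff algebra_simps)
            then show ?thesis by (simp only: power_int_of_nat)
          qed
          then have "u ^ (j - (r - l)) * inverse u ^ l = u powi (int j - int r)"
            using u by (simp add: power_inverse field_simps)
          then show ?thesis by simp
        qed (simp add: binomial_eq_0)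
      qed
      finally show ?thesis by (simp add: sum_distrib_right)
    qed
    then have "coeff (\<Sum>u\<in>UNIV - {0}.
        [:fls_const (u :: 'a), 1:] ^ j * [:1, (1 - Pf) * fls_const (inverse u):] ^ ?n) r =
        (\<Sum>l\<le>r. ?s l) * fls_const (\<Sum>u\<in>UNIV - {0}. u powi (int j - int r))"
      unfolding coeff_sum fls_const_sum sum_distrib_left by (intro sum.cong) auto
    then show ?thesis by (simp only: sum_power_int_nonzero) simp
  qed
  show ?thesis by (simp only: hecke_form_def coeff_add coeff_diff 1 2 3 diff_minus_eq_add)
qed

text \<open>Coordinates in different residue classes modulo \<open>CARD('a) - 1\<close> do not
  interact, which is the source of the invariance of each summand.\<close>

lemma coeff_hecke_form_not_dvd:
  assumes "j \<le> k - 2" "\<not> int (CARD('a) - 1) dvd int j - int r"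
  shows "coeff (hecke_form j) r = 0"
proof -
  have "\<not> (r < j \<and> (CARD('a) - 1) dvd (j - r))"
    using assms(2) by (metis int_dvd_int_iff of_nat_diff less_imp_le)
  moreover have "\<not> (j < r \<and> (CARD('a) - 1) dvd (r - j))"
    using assms(2) by (metis dvd_diff_commute int_dvd_int_iff of_nat_diff less_imp_le)
  ultimately show ?thesis
    using assms(2) by (simp only: coeff_hecke_form[OF assms(1)] if_False add_0)
qed

text \<open>The row \<mu> fixes the form and the column \<nu> the coefficient. Above the diagonal
  only the second and third sums contribute, below it only the first and third, on it only the
  third; reflecting \<open>j choose (r - l)\<close> gives the binomials of \<open>beta\<close> and
  \<open>alpha\<close>.\<close>

lemma coeff_hecke_form_eq_heckeM:
  assumes \<mu>: "i + \<mu> * (CARD('a) - 1) \<le> k - 2" and \<nu>: "i + \<nu> * (CARD('a) - 1) \<le> k - 2"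
  shows "coeff (hecke_form (i + \<mu> * (CARD('a) - 1))) (i + \<nu> * (CARD('a) - 1)) = heckeM P k i \<mu> \<nu>"
proof -
  define q where "q = CARD('a) - 1"
  have q: "q > 0" using card_field_ge_2[where 'a='a] by (simp add: q_def)
  define j where "j = i + \<mu> * q"
  define r where "r = i + \<nu> * q"
  have j: "j \<le> k - 2" using \<mu> by (simp add: j_def q_def)
  let ?n = "k - 2 - j"
  let ?s = "\<lambda>l. of_nat (?n choose l) * of_nat (j choose (r - l)) * (1 - Pf) ^ l :: 'a fls"
  have dvd: "int q dvd int j - int r"
    by (simp add: j_def r_def flip: left_diff_distrib)
  note coeff = coeff_hecke_form[OF j, of r, folded q_def]
  have main: "coeff (hecke_form j) r = heckeM P k i \<mu> \<nu>"
  proof (cases \<mu> \<nu> rule: linorder_cases)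
    case less
    define \<kappa> where "\<kappa> = \<nu> - \<mu>"
    have r: "r = j + \<kappa> * q" and \<kappa>: "\<kappa> > 0"
      using less by (auto simp: j_def r_def \<kappa>_def simp flip: add_mult_distrib)
    \<comment> \<open>For \<open>l < \<kappa> * q\<close> the factor \<open>j choose (r - l)\<close>
      vanishes, for \<open>l > ?n\<close> the factor \<open>?n choose l\<close>. After reflection
      \<open>j choose (l - \<kappa> * q)\<close> is zero for \<open>l > r\<close>, so the range can
      be completed to that of \<open>beta\<close>.\<close>
    have "(\<Sum>l\<le>r. ?s l) = (\<Sum>l\<in>{\<kappa> * q..?n} \<inter> {..r}. ?s l)"
      by (rule sum.mono_neutral_right) (auto simp: r not_le binomial_eq_0)
    also have "\<dots> = (\<Sum>l\<in>{\<kappa> * q..?n} \<inter> {..r}.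
        of_nat (j choose (l - \<kappa> * q)) * of_nat (?n choose l) * (1 - Pf) ^ l)"
    proof (intro sum.cong refl)
      fix l assume l: "l \<in> {\<kappa> * q..?n} \<inter> {..r}"
      then have "j choose (r - l) = j choose (l - \<kappa> * q)"
        by (subst binomial_symmetric) (auto simp: r)
      then show "?s l = of_nat (j choose (l - \<kappa> * q)) * of_nat (?n choose l) * (1 - Pf) ^ l"
        by simp
    qed
    also have "\<dots> = (\<Sum>l=\<kappa> * q..?n.
        of_nat (j choose (l - \<kappa> * q)) * of_nat (?n choose l) * (1 - Pf) ^ l)"
      by (rule sum.mono_neutral_left) (auto simp: r not_le binomial_eq_0)
    finally have "(\<Sum>l\<le>r. ?s l) = \<dots>" .
    moreover have "j < r" using \<kappa> q by (simp add: r)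
    moreover have "r - j = \<kappa> * q" by (simp add: r)
    moreover have "beta P k i \<mu> \<kappa> =
        (\<Sum>l=\<kappa> * q..?n. of_nat (j choose (l - \<kappa> * q)) * of_nat (?n choose l) * (1 - Pf) ^ l)
        - Pf ^ j * of_nat (?n choose (\<kappa> * q)) * T ^ (\<kappa> * q)"
      by (simp only: beta_def Let_def q_def j_def)
    ultimately have "coeff (hecke_form j) r = beta P k i \<mu> \<kappa>"
      using dvd by (simp add: coeff)
    then show ?thesis using less by (simp add: heckeM_def \<kappa>_def)
  next
    case equal
    then have r: "r = j" by (simp add: j_def r_def)
    have "(\<Sum>l\<le>r. ?s l) = (\<Sum>l=0..j. of_nat (j choose l) * of_nat (?n choose l) * (1 - Pf) ^ l)"
      by (intro sum.cong) (auto simp: r atMost_atLeast0 simp flip: binomial_symmetric)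
    \<comment> \<open>The power of \<open>Pf\<close> added on the diagonal cancels the one
      subtracted in \<open>alpha\<close>.\<close>
    moreover have "heckeM P k i \<mu> \<nu> =
        (\<Sum>l=0..j. of_nat (j choose l) * of_nat (?n choose l) * (1 - Pf) ^ l)"
      using equal by (simp add: heckeM_def alpha_def Let_def j_def q_def)
    ultimately show ?thesis using dvd by (simp add: coeff[unfolded r] r)
  next
    case greater
    define \<kappa> where "\<kappa> = \<mu> - \<nu>"
    have jr: "j = r + \<kappa> * q" and \<kappa>: "\<kappa> > 0"
      using greater by (auto simp: j_def r_def \<kappa>_def simp flip: add_mult_distrib)
    have "\<nu> = \<mu> - \<kappa>" using greater by (simp add: \<kappa>_def)
    then have r: "r = i + (\<mu> - \<kappa>) * q" by (simp add: r_def)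
    have "(\<Sum>l\<le>r. ?s l) = (\<Sum>l=0..r.
        of_nat (j choose (l + \<kappa> * q)) * of_nat (?n choose l) * (1 - Pf) ^ l)"
    proof (intro sum.cong)
      fix l assume l: "l \<in> {0..r}"
      then have "j choose (r - l) = j choose (l + \<kappa> * q)"
        by (subst binomial_symmetric) (auto simp: jr)
      then show "?s l = of_nat (j choose (l + \<kappa> * q)) * of_nat (?n choose l) * (1 - Pf) ^ l"
        by simp
    qed auto
    moreover have "j choose r = j choose (\<kappa> * q)"
      by (subst binomial_symmetric) (auto simp: jr)
    moreover have "r < j" using \<kappa> q by (simp add: jr)
    moreover have "j - r = \<kappa> * q" by (simp add: jr)
    moreover have "alpha P k i \<mu> \<kappa> =
        (\<Sum>l=0..r. of_nat (j choose (l + \<kappa> * q)) * of_nat (?n choose l) * (1 - Pf) ^ l)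
        - Pf ^ ?n * of_nat (j choose (\<kappa> * q))"
      by (simp only: alpha_def Let_def q_def j_def r)
    ultimately have "coeff (hecke_form j) r = alpha P k i \<mu> \<kappa>"
      using dvd by (simp add: coeff)
    then show ?thesis using greater by (simp add: heckeM_def \<kappa>_def)
  qed
  then show ?thesis by (simp only: j_def r_def q_def)
qed

end

section \<open>Invariance of the summands and the Hecke matrix on each of them\<close>

theorem theorem7p7:
  fixes P :: "'a::{finite,field} poly" and k :: nat and m :: int and i :: nat
    and \<iota> :: "'a fls \<Rightarrow> 'c::field" and c :: "'a fls m2 \<Rightarrow> nat \<Rightarrow> 'c"
  assumes "k \<ge> 2" and "degree P = 1" and "poly P 0 = 1" and "i \<le> CARD('a) - 2"
    and "\<iota> 1 = 1" and "\<And>x y. \<iota> (x + y) = \<iota> x + \<iota> y" and "\<And>x y. \<iota> (x * y) = \<iota> x * \<iota> y"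
    and "hcocycle k m \<iota> c"
    and "\<And>j. j \<notin> (\<lambda>\<nu>. i + \<nu> * (CARD('a) - 1)) ` Idx CARD('a) k i \<Longrightarrow> c gamma0 j = 0"
  shows "hcocycle k m \<iota> (hecke k m \<iota> P c)
    \<and> (\<forall>j. j \<notin> (\<lambda>\<nu>. i + \<nu> * (CARD('a) - 1)) ` Idx CARD('a) k i \<longrightarrow> hecke k m \<iota> P c gamma0 j = 0)
    \<and> (\<forall>\<mu>\<in>Idx CARD('a) k i.
         hecke k m \<iota> P c gamma0 (i + \<mu> * (CARD('a) - 1)) =
         (\<Sum>\<nu>\<in>Idx CARD('a) k i. \<iota> (heckeM P k i \<mu> \<nu>) * c gamma0 (i + \<nu> * (CARD('a) - 1))))"
proof -
  obtain e p where "P = [:e, p:]" "p \<noteq> 0"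
    using assms(2) by (metis degree1_coeffs)
  then have P: "P = [:1, p:]" "p \<noteq> 0" using assms(3) by auto
  interpret hecke_setting \<iota> P k m c p
    by unfold_locales (use assms P in auto)
  define q where "q = CARD('a) - 1"
  have q: "i < q" using assms(4) card_field_ge_2[where 'a='a] by (simp add: q_def)
  let ?I = "Idx CARD('a) k i"
  let ?f = "\<lambda>\<nu>. i + \<nu> * q"
  have I: "\<nu> \<in> ?I \<longleftrightarrow> ?f \<nu> \<le> k - 2" for \<nu> by (simp add: Idx_def q_def)
  have inj: "inj_on ?f ?I" using q by (auto simp: inj_on_def)
  have w0: "c gamma0 r = 0" if "r \<notin> ?f ` ?I" for r using assms(9) that by (simp only: q_def)
  \<comment> \<open>The value of \<open>c\<close> at \<open>gamma0\<close> is supported on the class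
    of \<open>i\<close>, so the pairing reduces to a sum over \<open>?I\<close>.\<close>
  have sum: "hecke k m \<iota> P c gamma0 j = (\<Sum>\<nu>\<in>?I. \<iota> (coeff (hecke_form j) (?f \<nu>)) * c gamma0 (?f \<nu>))"
    if "j \<le> k - 2" for j
  proof -
    have "hecke k m \<iota> P c gamma0 j = (\<Sum>r\<le>k - 2. \<iota> (coeff (hecke_form j) r) * c gamma0 r)"
      using hecke_gamma0[OF that assms(1)] by (simp add: pair_def)
    also have "\<dots> = (\<Sum>r\<in>?f ` ?I. \<iota> (coeff (hecke_form j) r) * c gamma0 r)"
      by (rule sum.mono_neutral_right) (auto simp: I w0)
    finally show ?thesis by (simp add: sum.reindex[OF inj])
  qed
  have "hecke k m \<iota> P c gamma0 j = 0" if j: "j \<notin> ?f ` ?I" for j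
  proof (cases "j \<le> k - 2")
    case True
    \<comment> \<open>As \<open>i < q\<close>, any \<open>j\<close> congruent to \<open>i\<close>
      modulo \<open>q\<close> has remainder exactly \<open>i\<close>, hence equals
      \<open>?f (j div q)\<close>; with \<open>j \<le> k - 2\<close> it would lie in the excluded
      set.\<close>
    have "\<not> int q dvd int j - int (?f \<nu>)" for \<nu>
    proof
      assume "int q dvd int j - int (?f \<nu>)"
      then have "int q dvd (int j - int (?f \<nu>)) + int \<nu> * int q" by (intro dvd_add) auto
      then have "int j mod int q = int i mod int q" by (simp add: mod_eq_dvd_iff)
      then have "j mod q = i" using q by (simp flip: zmod_int)
      then have "j = ?f (j div q)" using div_mult_mod_eq[of j q] by simp
      then show False using j True I by (metis imageI)
    qed
    then have "coeff (hecke_form j) (?f \<nu>) = 0" for \<nu>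
      using coeff_hecke_form_not_dvd[OF True, folded q_def] by blast
    then show ?thesis by (simp add: sum[OF True])
  next
    case False
    then show ?thesis by (simp add: hecke_eq_sum act_gt)
  qed
  moreover have "hecke k m \<iota> P c gamma0 (?f \<mu>) =
      (\<Sum>\<nu>\<in>?I. \<iota> (heckeM P k i \<mu> \<nu>) * c gamma0 (?f \<nu>))" if "\<mu> \<in> ?I" for \<mu>
    unfolding sum[OF that[unfolded I]]
    by (intro sum.cong refl) (use that coeff_hecke_form_eq_heckeM in \<open>simp add: I q_def\<close>)
  ultimately show ?thesis using hcocycle_hecke unfolding q_def by blast
qed

end
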